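(* Let $\boldsymbol w=[w_1,\ldots,w_m]^T>\boldsymbol 0$ with $\|\boldsymbol w\|_\infty=1$. Then the dimension of the sparse tensor product space $\widehat{\boldsymbol{\mathcal{H}}}_J^{\boldsymbol w}$ is proportional to $2^{J\max\{d_1/w_1,\ldots,d_m/w_m\}}J^{R-1}$, that is, $$\dim\widehat{\boldsymbol{\mathcal{H}}}_J^{\boldsymbol w}\sim 2^{J\max\{d_1/w_1,\ldots,d_m/w_m\}}\,J^{R-1}\qquad\text{for all } J\in\mathbb{N},\ J\ge 1,$$ where $R\in\mathbb{N}$ is the number of indices $i\in\{1,\ldots,m\}$ at which the maximum is attained.
   Context: Notation: $A\lesssim B$ means $A\le C B$ with a constant $C>0$; here constants do not depend on $J$. $A\sim B$ means $A\lesssim B$ and $B\lesssim A$. Inequalities between vectors are understood componentwise. Setting: Let $m\in\mathbb{N}$. For $i=1,\ldots,m$ let $\Omega_i\subset\mathbb{R}^{d_i}$, $d_i\in\mathbb{N}$, be a bounded Lipschitz domain, and let $\mathcal{H}^{(i)}$ be a reproducing kernel Hilbert space of real-valued functions on $\Omega_i$ with continuous positive definite reproducing kernel $\kappa_i$. Assume that $\mathcal{H}^{(i)}$ coincides with the Sobolev space $H^{s_i}(\Omega_i)$, $s_i>d_i/2$, with equivalent norms. Data sites: For a finite set $X\subset\Omega_i$, the fill distance is $h_{X,\Omega_i}=\sup_{x\in\Omega_i}\min_{y\in X}\|x-y\|_2$ and the separation distance is $q_X=\min_{x,y\in X,\,x\ne y}\|x-y\|_2$. For each $i$, let $X_0^{(i)}\subset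 X_1^{(i)}\subset X_2^{(i)}\subset\cdots\subset\Omega_i$ be a nested sequence of finite nonempty sets that are quasi-uniform (there is a constant $c_{\mathrm{qu}}>0$, independent of $j$, with $q_{X_j^{(i)}}\le h_{X_j^{(i)},\Omega_i}\le c_{\mathrm{qu}}\,q_{X_j^{(i)}}$) and satisfy $h_{X_j^{(i)},\Omega_i}\sim 2^{-j}$ (and consequently $|X_j^{(i)}|\sim 2^{jd_i}$), with constants independent of $j$. Spaces and projections: Let $\mathcal{H}_j^{(i)}=\operatorname{span}\{\kappa_i(\cdot,x):x\in X_j^{(i)}\}$, let $P_j^{(i)}:\mathcal{H}^{(i)}\to\mathcal{H}_j^{(i)}$ be the $\mathcal{H}^{(i)}$-orthogonal projection, $P_{-1}^{(i)}=0$, and $Q_j^{(i)}=P_j^{(i)}-P_{j-1}^{(i)}$ for $j\ge 0$. Let $\boldsymbol{\mathcal{H}}=\bigotimes_{i=1}^m\mathcal{H}^{(i)}$ (Hilbert space tensor product), and for $\boldsymbol j\in\mathbb{N}_0^m$ let $\boldsymbol Q_{\boldsymbol j}=Q_{j_1}^{(1)}\otimes\cdots\otimes Q_{j_m}^{(m)}$ and $\boldsymbol{\mathcal{W}}_{\boldsymbol j}=\boldsymbol Q_{\boldsymbol j}(\boldsymbol{\mathcal{H}})$. The (weighted) sparse tensor product space of level $J$ is $$\widehat{\boldsymbol{\mathcal{H}}}_J^{\boldsymbol w}=\bigoplus_{\boldsymbol j\in\mathbb{N}_0^m,\ \boldsymbol j^T\boldsymbol w\le J}\boldsymbol{\mathcal{W}}_{\boldsymbol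 j}.$$ *)

theory Defs
  imports "HOL-Analysis.Analysis" "HOL-Library.Function_Algebras"
begin

section \<open>Euclidean space of dimension \<open>d\<close>\<close>

text \<open>
  The dimensions \<open>d i\<close> vary with \<open>i\<close>, so points of all of the spaces are functions
  \<open>nat \<Rightarrow> real\<close>; those of dimension \<open>d\<close> are extensional on \<open>{..<d}\<close>, which makes
  \<open>rspace d\<close> the underlying set of the product measure \<open>leb d\<close>.  The product topology
  on \<open>nat \<Rightarrow> real\<close> induces the Euclidean topology on \<open>rspace d\<close>.  The library metric on
  \<open>nat \<Rightarrow> real\<close> is not the Euclidean one (it is bounded), hence \<open>enorm\<close> and \<open>edist\<close>.
\<close>

type_synonym point = "nat \<Rightarrow> real"

definition rspace :: "nat \<Rightarrow> point set" where
  "rspace d = ({..<d} \<rightarrow>\<^sub>E UNIV)"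

definition leb :: "nat \<Rightarrow> point measure" where
  "leb d = (\<Pi>\<^sub>M k\<in>{..<d}. lborel)"

definition enorm :: "nat \<Rightarrow> point \<Rightarrow> real" where
  "enorm d x = L2_set x {..<d}"

definition edist :: "nat \<Rightarrow> point \<Rightarrow> point \<Rightarrow> real" where
  "edist d x y = L2_set (\<lambda>k. x k - y k) {..<d}"

section \<open>Bounded Lipschitz domains\<close>

definition orthonormal :: "nat \<Rightarrow> (nat \<Rightarrow> point) \<Rightarrow> bool" where
  "orthonormal d e \<longleftrightarrow>
     (\<forall>k<d. \<forall>l<d. (\<Sum>p<d. e k p * e l p) = (if k = l then 1 else 0))"

definition coordinate :: "nat \<Rightarrow> (nat \<Rightarrow> point) \<Rightarrow> point \<Rightarrow> nat \<Rightarrow> real" where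
  "coordinate d e x k = (\<Sum>p<d. e k p * x p)"

text \<open>
  Near each boundary point the domain is, in a suitable orthonormal coordinate system, the
  part above the graph of a Lipschitz function of the first \<open>d - 1\<close> coordinates.
\<close>

definition bounded_lipschitz_domain :: "nat \<Rightarrow> point set \<Rightarrow> bool" where
  "bounded_lipschitz_domain d \<Omega> \<longleftrightarrow>
     \<Omega> \<noteq> {} \<and> openin (top_of_set (rspace d)) \<Omega> \<and> connected \<Omega> \<and>
     (\<exists>B. \<forall>x\<in>\<Omega>. enorm d x \<le> B) \<and>
     (\<forall>z \<in> top_of_set (rspace d) frontier_of \<Omega>.
        \<exists>r>0. \<exists>e \<phi> L. orthonormal d e \<and>
          (\<forall>y\<in>rspace (d - 1). \<forall>y'\<in>rspace (d - 1).
             \<bar>\<phi> y - \<phi> y'\<bar> \<le> L * edist (d - 1) y y') \<and>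
          (\<forall>x\<in>rspace d. edist d x z < r \<longrightarrow>
             (x \<in> \<Omega> \<longleftrightarrow> \<phi> (restrict (coordinate d e x) {..<d - 1}) < coordinate d e x (d - 1))))"

section \<open>Sobolev spaces of real order\<close>

definition partial :: "nat \<Rightarrow> (point \<Rightarrow> real) \<Rightarrow> point \<Rightarrow> real" where
  "partial k f x = deriv (\<lambda>t. f (x(k := t))) (x k)"

definition smooth :: "nat \<Rightarrow> (point \<Rightarrow> real) \<Rightarrow> bool" where
  "smooth d f \<longleftrightarrow>
     (\<forall>ks. set ks \<subseteq> {..<d} \<longrightarrow>
        continuous_on (rspace d) (foldr partial ks f) \<and>
        (\<forall>x\<in>rspace d. \<forall>k<d. (\<lambda>t. foldr partial ks f (x(k := t))) differentiable at (x k)))"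

definition test_function :: "nat \<Rightarrow> point set \<Rightarrow> (point \<Rightarrow> real) \<Rightarrow> bool" where
  "test_function d \<Omega> \<phi> \<longleftrightarrow>
     smooth d \<phi> \<and> (\<exists>K. compact K \<and> K \<subseteq> \<Omega> \<and> (\<forall>x \<in> rspace d - K. \<phi> x = 0))"

definition multi_indices :: "nat \<Rightarrow> nat \<Rightarrow> (nat \<Rightarrow> nat) set" where
  "multi_indices d n = {\<alpha>. (\<forall>k\<ge>d. \<alpha> k = 0) \<and> (\<Sum>k<d. \<alpha> k) = n}"

definition multi_deriv :: "nat \<Rightarrow> (nat \<Rightarrow> nat) \<Rightarrow> (point \<Rightarrow> real) \<Rightarrow> point \<Rightarrow> real" where
  "multi_deriv d \<alpha> f = foldr (\<lambda>k. partial k ^^ \<alpha> k) [0..<d] f"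

definition square_integrable :: "nat \<Rightarrow> point set \<Rightarrow> (point \<Rightarrow> real) \<Rightarrow> bool" where
  "square_integrable d \<Omega> f \<longleftrightarrow>
     set_borel_measurable (leb d) \<Omega> f \<and> set_integrable (leb d) \<Omega> (\<lambda>x. (f x)\<^sup>2)"

definition has_weak_deriv ::
    "nat \<Rightarrow> point set \<Rightarrow> (nat \<Rightarrow> nat) \<Rightarrow> (point \<Rightarrow> real) \<Rightarrow> (point \<Rightarrow> real) \<Rightarrow> bool" where
  "has_weak_deriv d \<Omega> \<alpha> f g \<longleftrightarrow>
     square_integrable d \<Omega> g \<and>
     (\<forall>\<phi>. test_function d \<Omega> \<phi> \<longrightarrow>
        (LINT x:\<Omega>|leb d. f x * multi_deriv d \<alpha> \<phi> x) =
          (- 1) ^ (\<Sum>k<d. \<alpha> k) * (LINT x:\<Omega>|leb d. g x * \<phi> x))"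

text \<open>Weak derivatives are unique almost everywhere; only integrals of them are used.\<close>

definition weak_deriv ::
    "nat \<Rightarrow> point set \<Rightarrow> (nat \<Rightarrow> nat) \<Rightarrow> (point \<Rightarrow> real) \<Rightarrow> point \<Rightarrow> real" where
  "weak_deriv d \<Omega> \<alpha> f = (SOME g. has_weak_deriv d \<Omega> \<alpha> f g)"

definition slobodeckij :: "nat \<Rightarrow> point set \<Rightarrow> real \<Rightarrow> (point \<Rightarrow> real) \<Rightarrow> ennreal" where
  "slobodeckij d \<Omega> \<sigma> g =
     (\<integral>\<^sup>+x\<in>\<Omega>. (\<integral>\<^sup>+y\<in>\<Omega>.
        ennreal ((g x - g y)\<^sup>2 / edist d x y powr (real d + 2 * \<sigma>)) \<partial>leb d) \<partial>leb d)"

text \<open>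
  The Sobolev--Slobodeckij space of order \<open>s = n + \<sigma>\<close> with \<open>n = \<lfloor>s\<rfloor>\<close>.  Its elements are
  functions here, not yet identified almost everywhere.
\<close>

definition sobolev :: "nat \<Rightarrow> point set \<Rightarrow> real \<Rightarrow> (point \<Rightarrow> real) set" where
  "sobolev d \<Omega> s =
     {f. square_integrable d \<Omega> f \<and>
         (\<forall>n \<le> nat \<lfloor>s\<rfloor>. \<forall>\<alpha>\<in>multi_indices d n. \<exists>g. has_weak_deriv d \<Omega> \<alpha> f g) \<and>
         (frac s > 0 \<longrightarrow>
            (\<forall>\<alpha>\<in>multi_indices d (nat \<lfloor>s\<rfloor>).
               slobodeckij d \<Omega> (frac s) (weak_deriv d \<Omega> \<alpha> f) < \<infinity>))}"

definition sobolev_norm :: "nat \<Rightarrow> point set \<Rightarrow> real \<Rightarrow> (point \<Rightarrow> real) \<Rightarrow> real" where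
  "sobolev_norm d \<Omega> s f =
     sqrt ((\<Sum>n\<le>nat \<lfloor>s\<rfloor>. \<Sum>\<alpha>\<in>multi_indices d n. LINT x:\<Omega>|leb d. (weak_deriv d \<Omega> \<alpha> f x)\<^sup>2) +
           (if frac s > 0
            then \<Sum>\<alpha>\<in>multi_indices d (nat \<lfloor>s\<rfloor>).
                   enn2real (slobodeckij d \<Omega> (frac s) (weak_deriv d \<Omega> \<alpha> f))
            else 0))"

section \<open>Reproducing kernel Hilbert spaces\<close>

text \<open>
  A Hilbert space of real-valued functions is given by its carrier \<open>H\<close> and its inner product
  \<open>ip\<close>.  A real-valued function on \<open>\<Omega>\<close> is represented by its extension by zero, so that
  the vector space operations are the pointwise ones on \<open>'a \<Rightarrow> real\<close>.
\<close>

interpretation fn: vector_space "\<lambda>(c::real) (f::'a \<Rightarrow> real) x. c * f x"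
  by unfold_locales (auto simp: fun_eq_iff algebra_simps)

definition hilbert_function_space ::
    "('a \<Rightarrow> real) set \<Rightarrow> (('a \<Rightarrow> real) \<Rightarrow> ('a \<Rightarrow> real) \<Rightarrow> real) \<Rightarrow> bool" where
  "hilbert_function_space H ip \<longleftrightarrow>
     fn.subspace H \<and>
     (\<forall>f\<in>H. \<forall>g\<in>H. ip f g = ip g f) \<and>
     (\<forall>f\<in>H. \<forall>g\<in>H. \<forall>h\<in>H. ip (f + g) h = ip f h + ip g h) \<and>
     (\<forall>f\<in>H. \<forall>g\<in>H. \<forall>c. ip (\<lambda>x. c * f x) g = c * ip f g) \<and>
     (\<forall>f\<in>H. 0 \<le> ip f f \<and> (ip f f = 0 \<longrightarrow> f = 0)) \<and>
     (\<forall>u. (\<forall>n::nat. u n \<in> H) \<and>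
          (\<forall>\<epsilon>>0. \<exists>N. \<forall>p\<ge>N. \<forall>q\<ge>N. sqrt (ip (u p - u q) (u p - u q)) < \<epsilon>) \<longrightarrow>
          (\<exists>f\<in>H. (\<lambda>n. sqrt (ip (u n - f) (u n - f))) \<longlonglongrightarrow> 0))"

definition kernel_section :: "'a set \<Rightarrow> ('a \<Rightarrow> 'a \<Rightarrow> real) \<Rightarrow> 'a \<Rightarrow> 'a \<Rightarrow> real" where
  "kernel_section \<Omega> \<kappa> x = (\<lambda>y. if y \<in> \<Omega> then \<kappa> y x else 0)"

definition rkhs ::
    "'a set \<Rightarrow> ('a \<Rightarrow> real) set \<Rightarrow> (('a \<Rightarrow> real) \<Rightarrow> ('a \<Rightarrow> real) \<Rightarrow> real) \<Rightarrow>
     ('a \<Rightarrow> 'a \<Rightarrow> real) \<Rightarrow> bool" where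
  "rkhs \<Omega> H ip \<kappa> \<longleftrightarrow>
     hilbert_function_space H ip \<and>
     (\<forall>f\<in>H. \<forall>x. x \<notin> \<Omega> \<longrightarrow> f x = 0) \<and>
     (\<forall>x\<in>\<Omega>. kernel_section \<Omega> \<kappa> x \<in> H) \<and>
     (\<forall>f\<in>H. \<forall>x\<in>\<Omega>. ip f (kernel_section \<Omega> \<kappa> x) = f x)"

text \<open>
  Positive definiteness is strict, as usual in scattered data approximation: kernel matrices of
  distinct points are positive definite, not just semidefinite.
\<close>

definition positive_definite_kernel :: "'a set \<Rightarrow> ('a \<Rightarrow> 'a \<Rightarrow> real) \<Rightarrow> bool" where
  "positive_definite_kernel \<Omega> \<kappa> \<longleftrightarrow>
     (\<forall>x\<in>\<Omega>. \<forall>y\<in>\<Omega>. \<kappa> x y = \<kappa> y x) \<and>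
     (\<forall>X a. finite X \<and> X \<subseteq> \<Omega> \<and> (\<exists>x\<in>X. a x \<noteq> 0) \<longrightarrow>
        (\<Sum>x\<in>X. \<Sum>y\<in>X. a x * a y * \<kappa> x y) > 0)"

text \<open>
  \<open>H\<close> coincides with the Sobolev space as a space of classes modulo equality almost
  everywhere, with equivalent norms.
\<close>

definition coincides_with_sobolev ::
    "nat \<Rightarrow> point set \<Rightarrow> real \<Rightarrow> (point \<Rightarrow> real) set \<Rightarrow>
     ((point \<Rightarrow> real) \<Rightarrow> (point \<Rightarrow> real) \<Rightarrow> real) \<Rightarrow> bool" where
  "coincides_with_sobolev d \<Omega> s H ip \<longleftrightarrow>
     H \<subseteq> sobolev d \<Omega> s \<and>
     (\<forall>g\<in>sobolev d \<Omega> s. \<exists>f\<in>H. AE x in leb d. x \<in> \<Omega> \<longrightarrow> f x = g x) \<and>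
     (\<exists>c>0. \<exists>C>0. \<forall>f\<in>H. c * sobolev_norm d \<Omega> s f \<le> sqrt (ip f f) \<and>
                       sqrt (ip f f) \<le> C * sobolev_norm d \<Omega> s f)"

section \<open>Data sites\<close>

definition lesssim_on :: "'a set \<Rightarrow> ('a \<Rightarrow> real) \<Rightarrow> ('a \<Rightarrow> real) \<Rightarrow> bool" where
  "lesssim_on S f g \<longleftrightarrow> (\<exists>C>0. \<forall>x\<in>S. f x \<le> C * g x)"

definition sim_on :: "'a set \<Rightarrow> ('a \<Rightarrow> real) \<Rightarrow> ('a \<Rightarrow> real) \<Rightarrow> bool" where
  "sim_on S f g \<longleftrightarrow> lesssim_on S f g \<and> lesssim_on S g f"

definition fill_distance :: "nat \<Rightarrow> point set \<Rightarrow> point set \<Rightarrow> real" where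
  "fill_distance d X \<Omega> = (SUP x\<in>\<Omega>. Min ((\<lambda>y. edist d x y) ` X))"

definition separation_distance :: "nat \<Rightarrow> point set \<Rightarrow> real" where
  "separation_distance d X = Min {edist d x y | x y. x \<in> X \<and> y \<in> X \<and> x \<noteq> y}"

text \<open>
  The separation distance of a single point is a minimum over the empty set, so the
  quasi-uniformity bounds are imposed on sets of at least two points.
\<close>

definition quasi_uniform :: "nat \<Rightarrow> point set \<Rightarrow> (nat \<Rightarrow> point set) \<Rightarrow> bool" where
  "quasi_uniform d \<Omega> X \<longleftrightarrow>
     (\<exists>c>0. \<forall>j. card (X j) \<ge> 2 \<longrightarrow>
        separation_distance d (X j) \<le> fill_distance d (X j) \<Omega> \<and>
        fill_distance d (X j) \<Omega> \<le> c * separation_distance d (X j))"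

definition data_sites :: "nat \<Rightarrow> point set \<Rightarrow> (nat \<Rightarrow> point set) \<Rightarrow> bool" where
  "data_sites d \<Omega> X \<longleftrightarrow>
     (\<forall>j. finite (X j) \<and> X j \<noteq> {} \<and> X j \<subseteq> \<Omega> \<and> X j \<subseteq> X (Suc j)) \<and>
     quasi_uniform d \<Omega> X \<and>
     sim_on UNIV (\<lambda>j. fill_distance d (X j) \<Omega>) (\<lambda>j. 2 powr (- real j))"

section \<open>Projections\<close>

definition kernel_space :: "'a set \<Rightarrow> ('a \<Rightarrow> 'a \<Rightarrow> real) \<Rightarrow> 'a set \<Rightarrow> ('a \<Rightarrow> real) set" where
  "kernel_space \<Omega> \<kappa> X = fn.span (kernel_section \<Omega> \<kappa> ` X)"

definition orthogonal_projection ::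
    "(('a \<Rightarrow> real) \<Rightarrow> ('a \<Rightarrow> real) \<Rightarrow> real) \<Rightarrow> ('a \<Rightarrow> real) set \<Rightarrow> ('a \<Rightarrow> real) \<Rightarrow> 'a \<Rightarrow> real" where
  "orthogonal_projection ip V f = (THE g. g \<in> V \<and> (\<forall>h\<in>V. ip (f - g) h = 0))"

definition detail_projection ::
    "'a set \<Rightarrow> (('a \<Rightarrow> real) \<Rightarrow> ('a \<Rightarrow> real) \<Rightarrow> real) \<Rightarrow> ('a \<Rightarrow> 'a \<Rightarrow> real) \<Rightarrow>
     (nat \<Rightarrow> 'a set) \<Rightarrow> nat \<Rightarrow> ('a \<Rightarrow> real) \<Rightarrow> 'a \<Rightarrow> real" where
  "detail_projection \<Omega> ip \<kappa> X j f =
     orthogonal_projection ip (kernel_space \<Omega> \<kappa> (X j)) f -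
     (if j = 0 then 0 else orthogonal_projection ip (kernel_space \<Omega> \<kappa> (X (j - 1))) f)"

section \<open>Hilbert space tensor products\<close>

text \<open>
  The tensor factors are indexed by a finite type \<open>'m\<close>.  A Hilbert space \<open>'h\<close> together with
  a map \<open>tens\<close> taking \<open>(f i)\<^sub>i\<close> to the elementary tensor is the Hilbert space tensor product of
  the spaces \<open>H i\<close>; this determines it up to unitary isomorphism.
\<close>

definition hilbert_tensor_product ::
    "('m::finite \<Rightarrow> ('a \<Rightarrow> real) set) \<Rightarrow> ('m \<Rightarrow> ('a \<Rightarrow> real) \<Rightarrow> ('a \<Rightarrow> real) \<Rightarrow> real) \<Rightarrow>
     (('m \<Rightarrow> 'a \<Rightarrow> real) \<Rightarrow> 'h::{real_inner, complete_space}) \<Rightarrow> bool" where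
  "hilbert_tensor_product H ip tens \<longleftrightarrow>
     (\<forall>f \<in> Pi UNIV H. \<forall>i. \<forall>g\<in>H i. \<forall>h\<in>H i. \<forall>a b.
        tens (f(i := (\<lambda>x. a * g x + b * h x))) =
          a *\<^sub>R tens (f(i := g)) + b *\<^sub>R tens (f(i := h))) \<and>
     (\<forall>f \<in> Pi UNIV H. \<forall>g \<in> Pi UNIV H. tens f \<bullet> tens g = (\<Prod>i\<in>UNIV. ip i (f i) (g i))) \<and>
     closure (span (tens ` Pi UNIV H)) = UNIV"

definition tensor_operator ::
    "('m::finite \<Rightarrow> ('a \<Rightarrow> real) set) \<Rightarrow> (('m \<Rightarrow> 'a \<Rightarrow> real) \<Rightarrow> 'h::{real_inner, complete_space}) \<Rightarrow>
     ('m \<Rightarrow> ('a \<Rightarrow> real) \<Rightarrow> 'a \<Rightarrow> real) \<Rightarrow> 'h \<Rightarrow> 'h" where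
  "tensor_operator H tens A =
     (THE T. bounded_linear T \<and> (\<forall>f \<in> Pi UNIV H. T (tens f) = tens (\<lambda>i. A i (f i))))"

definition detail_space ::
    "('m::finite \<Rightarrow> 'a set) \<Rightarrow> ('m \<Rightarrow> ('a \<Rightarrow> real) set) \<Rightarrow>
     ('m \<Rightarrow> ('a \<Rightarrow> real) \<Rightarrow> ('a \<Rightarrow> real) \<Rightarrow> real) \<Rightarrow> ('m \<Rightarrow> 'a \<Rightarrow> 'a \<Rightarrow> real) \<Rightarrow>
     ('m \<Rightarrow> nat \<Rightarrow> 'a set) \<Rightarrow> (('m \<Rightarrow> 'a \<Rightarrow> real) \<Rightarrow> 'h::{real_inner, complete_space}) \<Rightarrow>
     ('m \<Rightarrow> nat) \<Rightarrow> 'h set" where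
  "detail_space \<Omega> H ip \<kappa> X tens j =
     range (tensor_operator H tens (\<lambda>i. detail_projection (\<Omega> i) (ip i) (\<kappa> i) (X i) (j i)))"

text \<open>
  The sum of the detail spaces is direct because they are mutually orthogonal, and it has
  finitely many terms because all weights are positive.
\<close>

definition sparse_tensor_space ::
    "('m::finite \<Rightarrow> 'a set) \<Rightarrow> ('m \<Rightarrow> ('a \<Rightarrow> real) set) \<Rightarrow>
     ('m \<Rightarrow> ('a \<Rightarrow> real) \<Rightarrow> ('a \<Rightarrow> real) \<Rightarrow> real) \<Rightarrow> ('m \<Rightarrow> 'a \<Rightarrow> 'a \<Rightarrow> real) \<Rightarrow>
     ('m \<Rightarrow> nat \<Rightarrow> 'a set) \<Rightarrow> (('m \<Rightarrow> 'a \<Rightarrow> real) \<Rightarrow> 'h::{real_inner, complete_space}) \<Rightarrow>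
     real ^ 'm \<Rightarrow> nat \<Rightarrow> 'h set" where
  "sparse_tensor_space \<Omega> H ip \<kappa> X tens w J =
     span (\<Union>j \<in> {j. (\<Sum>i\<in>UNIV. real (j i) * w $ i) \<le> real J}. detail_space \<Omega> H ip \<kappa> X tens j)"

end

theory Submission
  imports Defs
begin

text \<open>
  Each factor \<open>H i\<close> has nested orthonormal bases \<open>E i j\<close> of its kernel spaces, obtained from
  the kernel sections by the Gram--Schmidt process; strict positive definiteness makes the
  sections independent, so \<open>E i j\<close> has as many elements as \<open>X i j\<close>.  The detail projection of level
  \<open>j\<close> is the Fourier sum over the vectors that are new in \<open>E i j\<close>
  (\<open>detail_projection_eq_fourier_sum\<close>).  Hence the tensor product of detail projections is an
  explicit finite sum, whose range is spanned by orthonormal tensors of new basis vectors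
  (\<open>range_tensor_operator\<close>), and the dimension of the sparse space is the number of these
  (\<open>dim_sparse_tensor_space\<close>): the sum over \<open>j\<close> in the weighted simplex of \<open>\<Prod>i. n i (j i)\<close>, where
  \<open>n i k\<close> is the number of vectors of level \<open>k\<close>.

  The geometry enters the count through the size of \<open>X i j\<close>, which is about \<open>2 ^ (d i * j)\<close>
  (\<open>card_data_sites\<close>) by a packing and covering argument with integer grids.
  Single levels may well contribute no new points, so there is no lower bound for the
  individual \<open>n i k\<close>; only their partial sums, the cardinalities of the \<open>X i j\<close>, are controlled.

  This suffices for the count (\<open>weighted_simplex_sum_asymptotics\<close>).  Summing first over one
  coordinate that attains the maximum \<open>\<rho>\<close> uses only partial sums and yields
  \<open>2 powr (J * \<rho>)\<close> times a sum over the other coordinates with terms discounted at rate \<open>\<rho>\<close>.  In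
  that sum each of the other \<open>R - 1\<close> maximizing coordinates contributes a factor \<open>J\<close>, the lower
  bound being a summation by parts (\<open>discounted_sum_ge\<close>), and every remaining coordinate
  contributes a convergent geometric series.
\<close>

section \<open>Nested orthonormal bases of kernel spaces\<close>

lemma sum_fun_apply: "(\<Sum>e\<in>E. F e) x = (\<Sum>e\<in>E. F e x)" for F :: "'b \<Rightarrow> 'a \<Rightarrow> real"
  by (induction E rule: infinite_finite_induct) auto

text \<open>
  Indexing the combination by \<open>Y\<close> rather than by \<open>k ` Y\<close> allows \<open>k\<close> to be used before it is
  known to be injective.
\<close>

lemma span_image_sums:
  fixes k :: "'b \<Rightarrow> 'a \<Rightarrow> real"
  assumes "finite Y" "f \<in> fn.span (k ` Y)"
  shows "\<exists>a. f = (\<Sum>y\<in>Y. (\<lambda>x. a y * k y x))"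
proof -
  let ?V = "range (\<lambda>a. \<Sum>y\<in>Y. (\<lambda>x. a y * k y x))"
  have "fn.subspace ?V"
  proof (rule fn.subspaceI)
    show "0 \<in> ?V"
      by (rule range_eqI[of _ _ "\<lambda>_. 0"]) (auto simp: fun_eq_iff sum_fun_apply)
  next
    fix f g assume "f \<in> ?V" "g \<in> ?V"
    then obtain a b where "f = (\<Sum>y\<in>Y. (\<lambda>x. a y * k y x))" "g = (\<Sum>y\<in>Y. (\<lambda>x. b y * k y x))"
      by auto
    then show "f + g \<in> ?V"
      by (intro range_eqI[of _ _ "\<lambda>y. a y + b y"])
         (auto simp: fun_eq_iff sum_fun_apply sum.distrib algebra_simps)
  next
    fix c f assume "f \<in> ?V"
    then obtain a where a: "f = (\<Sum>y\<in>Y. (\<lambda>x. a y * k y x))" by auto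
    have "(\<lambda>x. c * f x) = (\<Sum>y\<in>Y. (\<lambda>x. (c * a y) * k y x))"
      by (rule ext) (simp only: a sum_fun_apply sum_distrib_left mult.assoc)
    then show "(\<lambda>x. c * f x) \<in> ?V" by (rule range_eqI[of _ _ "\<lambda>y. c * a y"])
  qed
  moreover have "k ` Y \<subseteq> ?V"
  proof
    fix f assume "f \<in> k ` Y"
    then obtain y where y: "y \<in> Y" "f = k y" by auto
    show "f \<in> ?V"
      by (rule range_eqI[of _ _ "\<lambda>z. if z = y then 1 else 0"])
         (use y assms in \<open>auto simp: fun_eq_iff sum_fun_apply if_distrib[of "\<lambda>t. t * _"] cong: if_cong\<close>)
  qed
  ultimately have "fn.span (k ` Y) \<subseteq> ?V" by (rule fn.span_minimal[rotated])
  with assms show ?thesis by blast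
qed

definition orthonormal_set :: "(('a \<Rightarrow> real) \<Rightarrow> ('a \<Rightarrow> real) \<Rightarrow> real) \<Rightarrow> ('a \<Rightarrow> real) set \<Rightarrow> bool" where
  "orthonormal_set ip E \<longleftrightarrow> (\<forall>e\<in>E. \<forall>e'\<in>E. ip e e' = (if e = e' then 1 else 0))"

definition fourier_sum ::
    "(('a \<Rightarrow> real) \<Rightarrow> ('a \<Rightarrow> real) \<Rightarrow> real) \<Rightarrow> ('a \<Rightarrow> real) set \<Rightarrow> ('a \<Rightarrow> real) \<Rightarrow> 'a \<Rightarrow> real" where
  "fourier_sum ip E f = (\<Sum>e\<in>E. (\<lambda>x. ip f e * e x))"

locale hilbert_functions =
  fixes H :: "('a \<Rightarrow> real) set" and ip :: "('a \<Rightarrow> real) \<Rightarrow> ('a \<Rightarrow> real) \<Rightarrow> real"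
  assumes hilbert: "hilbert_function_space H ip"
begin

lemma subspace: "fn.subspace H"
  using hilbert by (simp add: hilbert_function_space_def)

lemma ip_sym: "f \<in> H \<Longrightarrow> g \<in> H \<Longrightarrow> ip f g = ip g f"
  using hilbert by (simp add: hilbert_function_space_def)

lemma ip_add: "f \<in> H \<Longrightarrow> g \<in> H \<Longrightarrow> h \<in> H \<Longrightarrow> ip (f + g) h = ip f h + ip g h"
  using hilbert by (simp add: hilbert_function_space_def)

lemma ip_scale: "f \<in> H \<Longrightarrow> g \<in> H \<Longrightarrow> ip (\<lambda>x. c * f x) g = c * ip f g"
  using hilbert by (simp add: hilbert_function_space_def)

lemma ip_pos: "f \<in> H \<Longrightarrow> f \<noteq> 0 \<Longrightarrow> ip f f > 0"
  using hilbert unfolding hilbert_function_space_def by (metis order_less_le)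

lemma ip_zero: "g \<in> H \<Longrightarrow> ip 0 g = 0"
  using ip_add[of 0 0 g] fn.subspace_0[OF subspace] by simp

lemma ip_diff:
  assumes "f \<in> H" "g \<in> H" "h \<in> H" shows "ip (f - g) h = ip f h - ip g h"
  using ip_add[of "f - g" g h] fn.subspace_diff[OF subspace] assms by simp

lemma ip_sum:
  assumes "\<And>e. e \<in> E \<Longrightarrow> F e \<in> H" "g \<in> H"
  shows "ip (\<Sum>e\<in>E. F e) g = (\<Sum>e\<in>E. ip (F e) g)"
  using assms(1)
proof (induction E rule: infinite_finite_induct)
  case (insert e E)
  have "sum F E \<in> H" using insert.prems by (intro fn.subspace_sum[OF subspace]) auto
  then have "ip (F e + sum F E) g = ip (F e) g + (\<Sum>e\<in>E. ip (F e) g)"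
    using ip_add[of "F e" "sum F E" g] insert assms(2) by auto
  then show ?case by (simp only: sum.insert[OF insert.hyps])
qed (auto simp: ip_zero assms(2))

lemma span_subset: "E \<subseteq> H \<Longrightarrow> fn.span E \<subseteq> H"
  using subspace by (rule fn.span_minimal[rotated])

lemma fourier_sum_in_span: "fourier_sum ip E f \<in> fn.span E"
  unfolding fourier_sum_def by (intro fn.span_sum fn.span_scale fn.span_base)

lemma fourier_sum_in: "E \<subseteq> H \<Longrightarrow> fourier_sum ip E f \<in> H"
  using fourier_sum_in_span span_subset by blast

lemma ip_fourier_sum:
  assumes E: "finite E" "E \<subseteq> H" "orthonormal_set ip E" and e: "e \<in> E"
  shows "ip (fourier_sum ip E f) e = ip f e"
proof -
  have "ip (fourier_sum ip E f) e = (\<Sum>b\<in>E. ip f b * ip b e)"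
    unfolding fourier_sum_def
  proof (subst ip_sum)
    show "(\<Sum>b\<in>E. ip (\<lambda>x. ip f b * b x) e) = (\<Sum>b\<in>E. ip f b * ip b e)"
      by (rule sum.cong[OF refl], rule ip_scale) (use E e in auto)
  qed (use E e fn.subspace_scale[OF subspace] in auto)
  also have "\<dots> = (\<Sum>b\<in>E. if b = e then ip f e else 0)"
    by (rule sum.cong) (use E e in \<open>auto simp: orthonormal_set_def\<close>)
  finally show ?thesis using E e by simp
qed

text \<open>
  The functions orthogonal to the residual form a subspace, so it suffices to test on the
  elements of \<open>E\<close>, where the Fourier coefficients of \<open>f\<close> and of its Fourier sum agree.
\<close>

lemma ip_residual:
  assumes E: "finite E" "E \<subseteq> H" "orthonormal_set ip E" and f: "f \<in> H" and h: "h \<in> fn.span E"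
  shows "ip (f - fourier_sum ip E f) h = 0"
proof -
  let ?r = "f - fourier_sum ip E f"
  have r: "?r \<in> H" using f fourier_sum_in[OF E(2)] fn.subspace_diff[OF subspace] by blast
  have "h \<in> {h \<in> H. ip h ?r = 0}"
  proof (rule set_mp[OF fn.span_minimal h])
    show "E \<subseteq> {h \<in> H. ip h ?r = 0}"
    proof
      fix e assume e: "e \<in> E"
      then have "ip ?r e = 0"
        using E f ip_fourier_sum[OF E] fourier_sum_in[OF E(2)] by (subst ip_diff) auto
      then show "e \<in> {h \<in> H. ip h ?r = 0}" using e E(2) r ip_sym by auto
    qed
    show "fn.subspace {h \<in> H. ip h ?r = 0}"
      by (rule fn.subspaceI)
         (use r fn.subspace_0[OF subspace] fn.subspace_add[OF subspace] fn.subspace_scale[OF subspace]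
          in \<open>auto simp: ip_add ip_scale ip_zero\<close>)
  qed
  then show ?thesis using ip_sym r by simp
qed

text \<open>
  Two candidates for the projection differ by an element of the span that is orthogonal to the
  span, hence to itself.  This turns the definite description into a finite sum.
\<close>

lemma orthogonal_projection_eq_fourier_sum:
  assumes E: "finite E" "E \<subseteq> H" "orthonormal_set ip E" and f: "f \<in> H"
  shows "orthogonal_projection ip (fn.span E) f = fourier_sum ip E f"
  unfolding orthogonal_projection_def
proof (rule the_equality)
  show "fourier_sum ip E f \<in> fn.span E \<and> (\<forall>h\<in>fn.span E. ip (f - fourier_sum ip E f) h = 0)"
    using ip_residual[OF E f] fourier_sum_in_span by blast
next
  fix g assume g: "g \<in> fn.span E \<and> (\<forall>h\<in>fn.span E. ip (f - g) h = 0)"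
  let ?p = "fourier_sum ip E f"
  have in_span: "?p - g \<in> fn.span E" using g fourier_sum_in_span fn.span_diff by blast
  have H: "?p - g \<in> H" "f - g \<in> H" "f - ?p \<in> H"
    using in_span g f span_subset[OF E(2)] fourier_sum_in[OF E(2)] fn.subspace_diff[OF subspace]
    by blast+
  have "ip (?p - g) (?p - g) = ip ((f - g) - (f - ?p)) (?p - g)" by simp
  also have "\<dots> = 0" using ip_diff[OF H(2,3,1)] g in_span ip_residual[OF E f in_span] by simp
  finally show "g = ?p" using ip_pos[OF H(1)] by force
qed

text \<open>
  The new vector is the normalized residual of \<open>v\<close>; the residual is nonzero because
  \<open>v\<close> lies outside the span.  Only \<open>e\<close> is added, the old vectors stay: this is what makes the
  bases of nested kernel spaces nested.
\<close>

lemma gram_schmidt_step: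
  assumes E: "finite E" "E \<subseteq> H" "orthonormal_set ip E" and v: "v \<in> H" "v \<notin> fn.span E"
  shows "\<exists>e. e \<in> H \<and> e \<notin> E \<and> orthonormal_set ip (insert e E) \<and>
             fn.span (insert e E) = fn.span (insert v E)"
proof -
  define p where "p = fourier_sum ip E v"
  define r where "r = v - p"
  define c where "c = 1 / sqrt (ip r r)"
  define e where "e = (\<lambda>x. c * r x)"
  have p: "p \<in> fn.span E" "p \<in> H"
    using fourier_sum_in_span fourier_sum_in[OF E(2)] by (auto simp: p_def)
  have r: "r \<in> H" using v p fn.subspace_diff[OF subspace] by (simp add: r_def)
  have "r \<noteq> 0" using v p by (auto simp: r_def)
  then have pos: "ip r r > 0" using ip_pos r by blast
  then have c: "c > 0" by (simp add: c_def)
  have eH: "e \<in> H" using r fn.subspace_scale[OF subspace] by (simp add: e_def)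
  have "ip e e = c * ip e r" using ip_scale[OF r eH, of c] ip_sym[OF r eH] by (simp add: e_def)
  also have "\<dots> = c * (c * ip r r)" using ip_scale[OF r r, of c] by (simp add: e_def)
  also have "\<dots> = 1" using pos by (simp add: c_def)
  finally have ee: "ip e e = 1" .
  have eb: "ip e b = 0" "ip b e = 0" if "b \<in> E" for b
  proof -
    show "ip e b = 0"
      using ip_scale[of r b c] r that E ip_residual[OF E v(1) fn.span_base[OF that]]
      by (auto simp: e_def r_def p_def)
    then show "ip b e = 0" using ip_sym eH that E(2) by auto
  qed
  have new: "e \<notin> E" using ee eb by force
  have "v = (\<lambda>x. (1 / c) * e x) + p" using c by (simp add: e_def r_def fun_eq_iff)
  moreover have "\<dots> \<in> fn.span (insert e E)"
    using p(1) fn.span_mono[of E "insert e E"]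
    by (intro fn.span_add fn.span_scale) (auto intro: fn.span_base)
  ultimately have v_in: "v \<in> fn.span (insert e E)" by simp
  have "e \<in> fn.span (insert v E)"
    unfolding e_def r_def using p(1) fn.span_mono[of E "insert v E"]
    by (intro fn.span_scale fn.span_diff) (auto intro: fn.span_base)
  with v_in have "fn.span (insert e E) = fn.span (insert v E)"
    unfolding fn.span_eq by (auto intro: fn.span_base)
  moreover have "orthonormal_set ip (insert e E)"
    using E(3) ee eb new by (auto simp: orthonormal_set_def)
  ultimately show ?thesis using eH new by blast
qed

end

text \<open>
  A linear dependency between kernel sections is a nonzero vector in the kernel of a kernel
  matrix, which contradicts strict positive definiteness.
\<close>

lemma kernel_section_not_in_span:
  assumes pd: "positive_definite_kernel \<Omega> \<kappa>" and Y: "finite Y" "Y \<subseteq> \<Omega>" and x: "x \<in> \<Omega>" "x \<notin> Y"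
  shows "kernel_section \<Omega> \<kappa> x \<notin> kernel_space \<Omega> \<kappa> Y"
proof
  assume "kernel_section \<Omega> \<kappa> x \<in> kernel_space \<Omega> \<kappa> Y"
  then obtain a where a: "kernel_section \<Omega> \<kappa> x = (\<Sum>y\<in>Y. (\<lambda>z. a y * kernel_section \<Omega> \<kappa> y z))"
    using span_image_sums[OF Y(1)] unfolding kernel_space_def by blast
  \<comment> \<open>The dependency, with all terms moved to one side.\<close>
  define b where "b = a(x := - 1)"
  have "(\<Sum>y\<in>insert x Y. b z * b y * \<kappa> z y) = 0" if z: "z \<in> insert x Y" for z
  proof -
    have "z \<in> \<Omega>" using z Y x by auto
    then have "\<kappa> z x = (\<Sum>y\<in>Y. a y * \<kappa> z y)"
      using fun_cong[OF a, of z] by (simp add: sum_fun_apply kernel_section_def)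
    moreover have "(\<Sum>y\<in>Y. b y * \<kappa> z y) = (\<Sum>y\<in>Y. a y * \<kappa> z y)"
      using x by (intro sum.cong) (auto simp: b_def)
    ultimately have "(\<Sum>y\<in>insert x Y. b y * \<kappa> z y) = 0"
      using x Y by (simp add: b_def)
    then show ?thesis by (simp add: mult.assoc flip: sum_distrib_left)
  qed
  then have "(\<Sum>z\<in>insert x Y. \<Sum>y\<in>insert x Y. b z * b y * \<kappa> z y) = 0"
    by (intro sum.neutral) blast
  moreover have "(\<Sum>z\<in>insert x Y. \<Sum>y\<in>insert x Y. b z * b y * \<kappa> z y) > 0"
  proof -
    have "finite (insert x Y) \<and> insert x Y \<subseteq> \<Omega> \<and> (\<exists>z\<in>insert x Y. b z \<noteq> 0)"
      using Y x by (auto simp: b_def)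
    then show ?thesis using pd unfolding positive_definite_kernel_def by blast
  qed
  ultimately show False by simp
qed

definition kernel_basis ::
    "'a set \<Rightarrow> ('a \<Rightarrow> real) set \<Rightarrow> (('a \<Rightarrow> real) \<Rightarrow> ('a \<Rightarrow> real) \<Rightarrow> real) \<Rightarrow>
     ('a \<Rightarrow> 'a \<Rightarrow> real) \<Rightarrow> 'a set \<Rightarrow> ('a \<Rightarrow> real) set \<Rightarrow> bool" where
  "kernel_basis \<Omega> H ip \<kappa> Y E \<longleftrightarrow> finite E \<and> E \<subseteq> H \<and> orthonormal_set ip E \<and>
     fn.span E = kernel_space \<Omega> \<kappa> Y \<and> card E = card Y"

text \<open>
  Adding the points of \<open>Z - Y\<close> one at a time, each by one Gram--Schmidt step, adds exactly one
  basis vector per point, so that the cardinalities of basis and point set stay equal.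
\<close>

lemma kernel_basis_extend:
  assumes rk: "rkhs \<Omega> H ip \<kappa>" and pd: "positive_definite_kernel \<Omega> \<kappa>"
    and E: "kernel_basis \<Omega> H ip \<kappa> Y E" and Z: "finite Z" "Y \<subseteq> Z" "Z \<subseteq> \<Omega>"
  shows "\<exists>E'. kernel_basis \<Omega> H ip \<kappa> Z E' \<and> E \<subseteq> E'"
proof -
  interpret hilbert_functions H ip using rk by unfold_locales (simp add: rkhs_def)
  have "finite (Z - Y)" using Z by blast
  then have "Y \<union> (Z - Y) \<subseteq> \<Omega> \<Longrightarrow> \<exists>E'. kernel_basis \<Omega> H ip \<kappa> (Y \<union> (Z - Y)) E' \<and> E \<subseteq> E'"
  proof (induction "Z - Y" arbitrary: Z rule: finite_induct)
    case empty
    then have "Y \<union> (Z - Y) = Y" by auto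
    then show ?case using E by auto
  next
    case (insert x F)
    have x: "x \<in> \<Omega>" "x \<notin> Y \<union> F" using insert by auto
    have F: "F = (Y \<union> F) - Y" using insert by auto
    have "\<exists>E'. kernel_basis \<Omega> H ip \<kappa> (Y \<union> (Y \<union> F - Y)) E' \<and> E \<subseteq> E'"
      using insert.prems insert.hyps(4) by (intro insert.hyps(3) F) auto
    then obtain E' where E': "kernel_basis \<Omega> H ip \<kappa> (Y \<union> F) E'" "E \<subseteq> E'" by auto
    have finY: "finite (Y \<union> F)" "Y \<union> F \<subseteq> \<Omega>"
      using insert Z finite_subset[OF Z(2)] by auto
    let ?v = "kernel_section \<Omega> \<kappa> x"
    have v: "?v \<in> H" using rk x by (simp add: rkhs_def)
    have span: "fn.span E' = fn.span (kernel_section \<Omega> \<kappa> ` (Y \<union> F))"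
      using E' by (simp add: kernel_basis_def kernel_space_def)
    have "?v \<notin> fn.span E'"
      using kernel_section_not_in_span[OF pd finY x] E' by (simp add: kernel_basis_def)
    then obtain e where e: "e \<in> H" "e \<notin> E'" "orthonormal_set ip (insert e E')"
        "fn.span (insert e E') = fn.span (insert ?v E')"
      using gram_schmidt_step[OF _ _ _ v] E' unfolding kernel_basis_def by metis
    have "fn.span (insert ?v E') = fn.span (kernel_section \<Omega> \<kappa> ` insert x (Y \<union> F))"
      by (simp only: image_insert fn.span_insert[of ?v] span)
    then have "kernel_basis \<Omega> H ip \<kappa> (insert x (Y \<union> F)) (insert e E')"
      using E' e x finY by (simp add: kernel_basis_def kernel_space_def)
    moreover have "Y \<union> (Z - Y) = insert x (Y \<union> F)" using insert by auto
    ultimately show ?case using E' by auto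
  qed
  then show ?thesis using Z by (simp add: Un_absorb1)
qed

lemma nested_kernel_bases:
  assumes rk: "rkhs \<Omega> H ip \<kappa>" and pd: "positive_definite_kernel \<Omega> \<kappa>"
    and X: "\<And>j. finite (X j)" "\<And>j. X j \<subseteq> \<Omega>" "\<And>j. X j \<subseteq> X (Suc j)"
  shows "\<exists>E. \<forall>j. kernel_basis \<Omega> H ip \<kappa> (X j) (E j) \<and> E j \<subseteq> E (Suc j)"
proof (rule dependent_nat_choice)
  have "kernel_basis \<Omega> H ip \<kappa> {} {}"
    by (simp add: kernel_basis_def kernel_space_def orthonormal_set_def)
  from kernel_basis_extend[OF rk pd this X(1) _ X(2), of 0]
  show "\<exists>E. kernel_basis \<Omega> H ip \<kappa> (X 0) E" by auto
  show "\<exists>E'. kernel_basis \<Omega> H ip \<kappa> (X (Suc n)) E' \<and> E \<subseteq> E'"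
    if "kernel_basis \<Omega> H ip \<kappa> (X n) E" for E n
    using kernel_basis_extend[OF rk pd that X(1) X(3) X(2)] .
qed

text \<open>
  The subtracted set at \<open>j = 0\<close> is empty, as the projection of level \<open>- 1\<close> is zero.
\<close>

definition increment :: "(nat \<Rightarrow> 'b set) \<Rightarrow> nat \<Rightarrow> 'b set" where
  "increment E j = E j - (if j = 0 then {} else E (j - 1))"

lemma increment_subset: "increment E j \<subseteq> E j"
  by (auto simp: increment_def)

lemma increment_disjoint:
  assumes "\<And>j. E j \<subseteq> E (Suc j)" "a \<noteq> b"
  shows "increment E a \<inter> increment E b = {}"
proof -
  have *: "increment E a \<inter> increment E b = {}" if "a < b" for a b
  proof -
    have "a \<le> b - 1" using that by linarith
    from lift_Suc_mono_le[of E, OF assms(1) this] have "E a \<subseteq> E (b - 1)" .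
    then show ?thesis using that increment_subset[of E a] by (auto simp: increment_def)
  qed
  show ?thesis using *[of a b] *[of b a] assms(2) by (cases "a < b") auto
qed

lemma sum_card_increment:
  assumes "\<And>j. E j \<subseteq> E (Suc j)" "\<And>j. finite (E j)"
  shows "(\<Sum>k\<le>j. card (increment E k)) = card (E j)"
proof (induction j)
  case 0
  then show ?case by (simp add: increment_def)
next
  case (Suc j)
  have "card (increment E (Suc j)) = card (E (Suc j)) - card (E j)"
    using assms by (simp add: increment_def card_Diff_subset)
  moreover have "card (E j) \<le> card (E (Suc j))" using assms by (intro card_mono)
  ultimately show ?case using Suc by simp
qed

text \<open>
  Since the bases are nested, the Fourier sum of level \<open>j - 1\<close> is part of that of level \<open>j\<close>, and the
  difference of the projections is the sum over the new basis vectors.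
\<close>

lemma detail_projection_eq_fourier_sum:
  assumes rk: "rkhs \<Omega> H ip \<kappa>"
    and E: "\<And>j. kernel_basis \<Omega> H ip \<kappa> (X j) (E j)" "\<And>j. E j \<subseteq> E (Suc j)" and f: "f \<in> H"
  shows "detail_projection \<Omega> ip \<kappa> X j f = fourier_sum ip (increment E j) f"
proof -
  interpret hilbert_functions H ip using rk by unfold_locales (simp add: rkhs_def)
  have P: "orthogonal_projection ip (kernel_space \<Omega> \<kappa> (X k)) f = fourier_sum ip (E k) f" for k
    using orthogonal_projection_eq_fourier_sum[of "E k" f] E(1)[of k] f
    by (simp add: kernel_basis_def)
  show ?thesis
  proof (cases j)
    case 0
    then show ?thesis by (simp add: detail_projection_def P increment_def)
  next
    case (Suc k)
    have "fourier_sum ip (E (Suc k) - E k) f = fourier_sum ip (E (Suc k)) f - fourier_sum ip (E k) f"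
      unfolding fourier_sum_def
      by (rule sum_diff) (use E(1)[of "Suc k"] E(2)[of k] in \<open>auto simp: kernel_basis_def\<close>)
    then show ?thesis using Suc by (simp add: detail_projection_def P increment_def)
  qed
qed

section \<open>Tensor products of finite-rank projections\<close>

locale hilbert_tensor =
  fixes H :: "'m::finite \<Rightarrow> ('a \<Rightarrow> real) set"
    and ip :: "'m \<Rightarrow> ('a \<Rightarrow> real) \<Rightarrow> ('a \<Rightarrow> real) \<Rightarrow> real"
    and tens :: "('m \<Rightarrow> 'a \<Rightarrow> real) \<Rightarrow> 'h::{real_inner, complete_space}"
  assumes factor: "\<And>i. hilbert_function_space (H i) (ip i)"
    and tensor: "hilbert_tensor_product H ip tens"
begin

sublocale factor: hilbert_functions "H i" "ip i" for i
  by unfold_locales (rule factor)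

lemma tens_linear:
  "f \<in> Pi UNIV H \<Longrightarrow> g \<in> H i \<Longrightarrow> h \<in> H i \<Longrightarrow>
    tens (f(i := (\<lambda>x. a * g x + b * h x))) = a *\<^sub>R tens (f(i := g)) + b *\<^sub>R tens (f(i := h))"
  using tensor unfolding hilbert_tensor_product_def by blast

lemma inner_tens:
  "f \<in> Pi UNIV H \<Longrightarrow> g \<in> Pi UNIV H \<Longrightarrow> tens f \<bullet> tens g = (\<Prod>i\<in>UNIV. ip i (f i) (g i))"
  using tensor unfolding hilbert_tensor_product_def by blast

lemma dense: "closure (span (tens ` Pi UNIV H)) = UNIV"
  using tensor unfolding hilbert_tensor_product_def by blast

lemma tens_sum:
  assumes f: "f \<in> Pi UNIV H" and D: "finite D" "D \<subseteq> H i"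
  shows "tens (f(i := (\<Sum>e\<in>D. (\<lambda>x. c e * e x)))) = (\<Sum>e\<in>D. c e *\<^sub>R tens (f(i := e)))"
  using D
proof (induction D rule: finite_induct)
  case empty
  have "0 \<in> H i" by (rule fn.subspace_0[OF factor.subspace])
  have "0 = (\<lambda>x. 0 * (0 :: 'a \<Rightarrow> real) x + 0 * (0 :: 'a \<Rightarrow> real) x)" by (simp add: fun_eq_iff)
  with tens_linear[OF f \<open>0 \<in> H i\<close> \<open>0 \<in> H i\<close>, of 0 0] show ?case
    by (simp only: sum.empty scaleR_zero_left add_0_left)
next
  case (insert e D)
  let ?s = "\<Sum>e\<in>D. (\<lambda>x. c e * e x)"
  have "?s \<in> H i"
    using insert by (intro fn.subspace_sum[OF factor.subspace] fn.subspace_scale[OF factor.subspace]) auto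
  moreover have "(\<Sum>e\<in>insert e D. (\<lambda>x. c e * e x)) = (\<lambda>x. c e * e x + 1 * ?s x)"
    by (rule ext) (simp only: sum.insert[OF insert.hyps] plus_fun_apply mult_1)
  ultimately have "tens (f(i := (\<Sum>e\<in>insert e D. (\<lambda>x. c e * e x)))) =
      c e *\<^sub>R tens (f(i := e)) + 1 *\<^sub>R tens (f(i := ?s))"
    using tens_linear[OF f, of e i ?s "c e" 1] insert.prems by (simp only: insert_subset simp_thms)
  moreover have "tens (f(i := ?s)) = (\<Sum>e\<in>D. c e *\<^sub>R tens (f(i := e)))"
    using insert by blast
  ultimately show ?case by (simp only: sum.insert[OF insert.hyps] scaleR_one)
qed

text \<open>
  Full multilinear expansion, proved for a subset \<open>I\<close> of the slots at a time so that it can be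
  obtained by induction on \<open>I\<close>; the remaining slots hold a fixed \<open>f\<close>.
\<close>

lemma tens_multilinear_expansion:
  assumes f: "f \<in> Pi UNIV H" and D: "\<And>i. finite (D i)" "\<And>i. D i \<subseteq> H i" and I: "finite I"
  shows "tens (\<lambda>i. if i \<in> I then \<Sum>e\<in>D i. (\<lambda>x. c i e * e x) else f i) =
    (\<Sum>k\<in>Pi\<^sub>E I D. (\<Prod>i\<in>I. c i (k i)) *\<^sub>R tens (\<lambda>i. if i \<in> I then k i else f i))"
  using I f
proof (induction I arbitrary: f rule: finite_induct)
  case empty
  then show ?case by simp
next
  case (insert i0 I)
  let ?s = "\<lambda>i. \<Sum>e\<in>D i. (\<lambda>x. c i e * e x)"
  let ?F = "\<lambda>i. if i \<in> I then ?s i else f i"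
  have s: "?s i \<in> H i" for i
    using D by (intro fn.subspace_sum[OF factor.subspace] fn.subspace_scale[OF factor.subspace]) auto
  have F: "?F \<in> Pi UNIV H" using s insert.prems by auto
  have fe: "f(i0 := e) \<in> Pi UNIV H" if "e \<in> D i0" for e
    using insert.prems that D(2)[of i0] by (auto simp: Pi_iff)
  have eq1: "?F(i0 := e) = (\<lambda>i. if i \<in> I then ?s i else (f(i0 := e)) i)" for e
    using insert.hyps by (auto simp: fun_eq_iff)
  have eq2: "(\<lambda>i. if i \<in> I then k i else (f(i0 := e)) i) =
      (\<lambda>i. if i \<in> insert i0 I then (k(i0 := e)) i else f i)" for e k
    using insert.hyps by (auto simp: fun_eq_iff)
  have "(\<lambda>i. if i \<in> insert i0 I then ?s i else f i) = ?F(i0 := ?s i0)"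
    by (auto simp: fun_eq_iff)
  then have "tens (\<lambda>i. if i \<in> insert i0 I then ?s i else f i) =
      (\<Sum>e\<in>D i0. c i0 e *\<^sub>R tens (?F(i0 := e)))"
    using tens_sum[OF F D(1) D(2)] by simp
  also have "\<dots> = (\<Sum>e\<in>D i0. \<Sum>k\<in>Pi\<^sub>E I D. (c i0 e * (\<Prod>i\<in>I. c i (k i))) *\<^sub>R
      tens (\<lambda>i. if i \<in> insert i0 I then (k(i0 := e)) i else f i))"
    unfolding eq1 using insert.IH[OF fe]
    by (intro sum.cong refl) (simp only: eq2 scaleR_sum_right scaleR_scaleR)
  also have "\<dots> = (\<Sum>(e, k)\<in>D i0 \<times> Pi\<^sub>E I D. (\<Prod>i\<in>insert i0 I. c i ((k(i0 := e)) i)) *\<^sub>R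
      tens (\<lambda>i. if i \<in> insert i0 I then (k(i0 := e)) i else f i))"
    unfolding sum.cartesian_product
  proof (rule sum.cong[OF refl], clarify)
    fix e k
    have "(\<Prod>i\<in>I. c i ((k(i0 := e)) i)) = (\<Prod>i\<in>I. c i (k i))"
      using insert.hyps by (intro prod.cong) auto
    then have "c i0 e * (\<Prod>i\<in>I. c i (k i)) = (\<Prod>i\<in>insert i0 I. c i ((k(i0 := e)) i))"
      using insert.hyps by simp
    then show "(c i0 e * (\<Prod>i\<in>I. c i (k i))) *\<^sub>R
        tens (\<lambda>i. if i \<in> insert i0 I then (k(i0 := e)) i else f i) =
      (\<Prod>i\<in>insert i0 I. c i ((k(i0 := e)) i)) *\<^sub>R
        tens (\<lambda>i. if i \<in> insert i0 I then (k(i0 := e)) i else f i)"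
      by (simp only:)
  qed
  also have "\<dots> = (\<Sum>k\<in>Pi\<^sub>E (insert i0 I) D. (\<Prod>i\<in>insert i0 I. c i (k i)) *\<^sub>R
      tens (\<lambda>i. if i \<in> insert i0 I then k i else f i))"
    unfolding PiE_insert_eq
    by (subst sum.reindex)
       (use inj_combinator[OF insert.hyps(2), of D] in \<open>simp_all only: comp_def case_prod_unfold\<close>)
  finally show ?case .
qed

text \<open>
  By multilinearity the coefficient of \<open>tens k\<close> is the product of the factorwise Fourier
  coefficients, which is the inner product of elementary tensors.  The right-hand side makes
  sense for every element of the tensor product in place of \<open>tens f\<close>, and so provides the
  tensor product of the operators.
\<close>

lemma tens_fourier_sums:
  assumes f: "f \<in> Pi UNIV H" and D: "\<And>i. finite (D i)" "\<And>i. D i \<subseteq> H i"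
  shows "tens (\<lambda>i. fourier_sum (ip i) (D i) (f i)) = (\<Sum>k\<in>Pi\<^sub>E UNIV D. (tens f \<bullet> tens k) *\<^sub>R tens k)"
proof -
  have "tens (\<lambda>i. fourier_sum (ip i) (D i) (f i)) =
      (\<Sum>k\<in>Pi\<^sub>E UNIV D. (\<Prod>i\<in>UNIV. ip i (f i) (k i)) *\<^sub>R tens k)"
    using tens_multilinear_expansion[OF f D finite, where I = UNIV and c = "\<lambda>i. ip i (f i)"]
    by (simp add: fourier_sum_def)
  also have "\<dots> = (\<Sum>k\<in>Pi\<^sub>E UNIV D. (tens f \<bullet> tens k) *\<^sub>R tens k)"
  proof (rule sum.cong[OF refl])
    fix k assume "k \<in> Pi\<^sub>E UNIV D"
    then have "k \<in> Pi UNIV H" using D(2) by (auto simp: PiE_iff)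
    then show "(\<Prod>i\<in>UNIV. ip i (f i) (k i)) *\<^sub>R tens k = (tens f \<bullet> tens k) *\<^sub>R tens k"
      by (simp add: inner_tens[OF f])
  qed
  finally show ?thesis .
qed

text \<open>
  A bounded operator is determined by its values on elementary tensors, as their span is dense.
\<close>

lemma tensor_operator_eqI:
  assumes T: "bounded_linear T" "\<And>f. f \<in> Pi UNIV H \<Longrightarrow> T (tens f) = tens (\<lambda>i. A i (f i))"
  shows "tensor_operator H tens A = T"
  unfolding tensor_operator_def
proof (rule the_equality)
  fix T' assume T': "bounded_linear T' \<and> (\<forall>f\<in>Pi UNIV H. T' (tens f) = tens (\<lambda>i. A i (f i)))"
  have "closed {x. T' x = T x}"
    using T' T(1) by (intro closed_Collect_eq linear_continuous_on) auto
  moreover have "span (tens ` Pi UNIV H) \<subseteq> {x. T' x = T x}"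
  proof
    fix x assume "x \<in> span (tens ` Pi UNIV H)"
    then have "T' x = T x"
      by (rule linear_eq_on_span[rotated -1])
         (use T T' in \<open>auto intro: bounded_linear.linear\<close>)
    then show "x \<in> {x. T' x = T x}" by simp
  qed
  ultimately have "closure (span (tens ` Pi UNIV H)) \<subseteq> {x. T' x = T x}"
    by (rule closure_minimal[rotated])
  then show "T' = T" using dense by auto
qed (use T in auto)

lemma orthonormal_tens:
  assumes D: "\<And>i. D i \<subseteq> H i" "\<And>i. orthonormal_set (ip i) (D i)"
    and k: "k \<in> Pi\<^sub>E UNIV D" "k' \<in> Pi\<^sub>E UNIV D"
  shows "tens k \<bullet> tens k' = (if k = k' then 1 else 0)"
proof -
  have in_D: "k i \<in> D i" "k' i \<in> D i" for i using k by (auto simp: PiE_iff)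
  then have "tens k \<bullet> tens k' = (\<Prod>i\<in>UNIV. if k i = k' i then 1 else 0)"
    using D by (subst inner_tens) (auto simp: orthonormal_set_def subset_iff)
  also have "\<dots> = (if k = k' then 1 else 0)"
    by (auto simp: fun_eq_iff prod_zero_iff)
  finally show ?thesis .
qed

text \<open>
  The tensor product of finite-rank orthogonal projections is the orthogonal projection
  onto the span of the tensors of basis vectors.
\<close>

lemma range_tensor_operator:
  assumes D: "\<And>i. finite (D i)" "\<And>i. D i \<subseteq> H i" "\<And>i. orthonormal_set (ip i) (D i)"
    and A: "\<And>i f. f \<in> H i \<Longrightarrow> A i f = fourier_sum (ip i) (D i) f"
  shows "range (tensor_operator H tens A) = span (tens ` Pi\<^sub>E UNIV D)"
proof -
  let ?T = "\<lambda>h. \<Sum>k\<in>Pi\<^sub>E UNIV D. (h \<bullet> tens k) *\<^sub>R tens k"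
  have bl: "bounded_linear ?T"
    by (intro bounded_linear_sum bounded_linear_scaleR_const bounded_linear_inner_left)
  have T: "tensor_operator H tens A = ?T"
  proof (rule tensor_operator_eqI[OF bl])
    fix f assume f: "f \<in> Pi UNIV H"
    then have "(\<lambda>i. A i (f i)) = (\<lambda>i. fourier_sum (ip i) (D i) (f i))"
      using A by (auto simp: fun_eq_iff Pi_iff)
    then show "?T (tens f) = tens (\<lambda>i. A i (f i))" using tens_fourier_sums[OF f D(1,2)] by simp
  qed
  have "tens k \<in> range ?T" if k: "k \<in> Pi\<^sub>E UNIV D" for k
  proof (rule range_eqI)
    have "finite (Pi\<^sub>E UNIV D)" using D by (intro finite_PiE) auto
    moreover have "?T (tens k) = (\<Sum>k'\<in>Pi\<^sub>E UNIV D. if k' = k then tens k else 0)"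
      using orthonormal_tens[OF D(2,3) k] by (intro sum.cong) auto
    ultimately show "tens k = ?T (tens k)" using k by simp
  qed
  moreover have "subspace (range ?T)"
    using bl by (intro linear_subspace_image bounded_linear.linear subspace_UNIV)
  ultimately have "span (tens ` Pi\<^sub>E UNIV D) \<subseteq> range ?T"
    by (intro span_minimal) auto
  moreover have "range ?T \<subseteq> span (tens ` Pi\<^sub>E UNIV D)"
    by (auto intro!: span_sum span_scale intro: span_base)
  ultimately show ?thesis using T by simp
qed

end

section \<open>Dimension of the sparse tensor product space\<close>

lemma finite_weighted_simplex:
  fixes w :: "'m::finite \<Rightarrow> real"
  assumes w: "\<And>i. w i > 0"
  shows "finite {j :: 'm \<Rightarrow> nat. (\<Sum>i\<in>UNIV. real (j i) * w i) \<le> t}"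
proof (rule finite_subset)
  show "finite (Pi\<^sub>E UNIV (\<lambda>i. {..nat \<lfloor>t / w i\<rfloor>}))" by (intro finite_PiE) auto
  show "{j :: 'm \<Rightarrow> nat. (\<Sum>i\<in>UNIV. real (j i) * w i) \<le> t} \<subseteq> Pi\<^sub>E UNIV (\<lambda>i. {..nat \<lfloor>t / w i\<rfloor>})"
  proof (intro subsetI PiE_I)
    fix j :: "'m \<Rightarrow> nat" and i
    assume "j \<in> {j. (\<Sum>i\<in>UNIV. real (j i) * w i) \<le> t}"
    moreover have "real (j i) * w i \<le> (\<Sum>i\<in>UNIV. real (j i) * w i)"
      by (intro member_le_sum mult_nonneg_nonneg less_imp_le[OF w]) auto
    ultimately have "real (j i) \<le> t / w i" using w[of i] by (auto simp: pos_le_divide_eq)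
    then show "j i \<in> {..nat \<lfloor>t / w i\<rfloor>}" by (simp add: le_nat_floor)
  qed auto
qed

text \<open>
  The tensors \<open>tens k\<close>, where the components of \<open>k\<close> are basis vectors that are new at the levels
  \<open>j i\<close> of an admissible \<open>j\<close>, form an orthonormal basis of the sparse space.  The
  index sets for distinct \<open>j\<close> are disjoint, so the dimension is their total cardinality.
\<close>

lemma dim_sparse_tensor_space:
  fixes H :: "'m::finite \<Rightarrow> ('a \<Rightarrow> real) set" and w :: "real ^ 'm"
    and tens :: "('m \<Rightarrow> 'a \<Rightarrow> real) \<Rightarrow> 'h::{real_inner, complete_space}"
  assumes rk: "\<And>i. rkhs (\<Omega> i) (H i) (ip i) (\<kappa> i)"
    and tensor: "hilbert_tensor_product H ip tens"
    and E: "\<And>i j. kernel_basis (\<Omega> i) (H i) (ip i) (\<kappa> i) (X i j) (E i j)"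
      "\<And>i j. E i j \<subseteq> E i (Suc j)"
    and w: "\<And>i. w $ i > 0"
  shows "dim (sparse_tensor_space \<Omega> H ip \<kappa> X tens w J) =
    (\<Sum>j\<in>{j. (\<Sum>i\<in>UNIV. real (j i) * w $ i) \<le> real J}. \<Prod>i\<in>UNIV. card (increment (E i) (j i)))"
proof -
  interpret hilbert_tensor H ip tens
    using rk tensor by unfold_locales (auto simp: rkhs_def)
  let ?S = "{j. (\<Sum>i\<in>UNIV. real (j i) * w $ i) \<le> real J}"
  define D where "D j = Pi\<^sub>E UNIV (\<lambda>i. increment (E i) (j i))" for j
  have incr: "finite (increment (E i) k)" "increment (E i) k \<subseteq> H i"
      "orthonormal_set (ip i) (increment (E i) k)" for i k
    using E(1)[of i k] increment_subset[of "E i" k]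
    by (auto simp: kernel_basis_def orthonormal_set_def subset_iff intro: finite_subset)
  have detail: "detail_space \<Omega> H ip \<kappa> X tens j = span (tens ` D j)" for j
    unfolding detail_space_def D_def
  proof (rule range_tensor_operator)
    show "finite (increment (E i) (j i))" "increment (E i) (j i) \<subseteq> H i"
        "orthonormal_set (ip i) (increment (E i) (j i))" for i
      by (rule incr)+
    fix i f assume f: "f \<in> H i"
    show "detail_projection (\<Omega> i) (ip i) (\<kappa> i) (X i) (j i) f =
        fourier_sum (ip i) (increment (E i) (j i)) f"
      by (rule detail_projection_eq_fourier_sum[OF rk[of i] _ _ f]) (rule E)+
  qed
  have "sparse_tensor_space \<Omega> H ip \<kappa> X tens w J = span (tens ` (\<Union>j\<in>?S. D j))"
    unfolding sparse_tensor_space_def detail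
  proof (rule span_unique[symmetric])
    show "tens ` (\<Union>j\<in>?S. D j) \<subseteq> span (\<Union>j\<in>?S. span (tens ` D j))"
      by (auto intro!: span_base)
    show "subspace (span (\<Union>j\<in>?S. span (tens ` D j)))" by simp
    fix T assume "tens ` (\<Union>j\<in>?S. D j) \<subseteq> T" "subspace T"
    then show "span (\<Union>j\<in>?S. span (tens ` D j)) \<subseteq> T"
      by (intro span_minimal UN_least) auto
  qed
  moreover have ortho: "tens k \<bullet> tens k' = (if k = k' then 1 else 0)"
    if k: "k \<in> (\<Union>j\<in>?S. D j)" "k' \<in> (\<Union>j\<in>?S. D j)" for k k'
  proof -
    from k obtain j j' where j: "k \<in> D j" "k' \<in> D j'" by blast
    \<comment> \<open>Nestedness puts any two basis tensors into one common product basis.\<close>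
    let ?D = "\<lambda>i. E i (max (j i) (j' i))"
    have "?D i \<subseteq> H i" "orthonormal_set (ip i) (?D i)" for i
      using E(1) by (auto simp: kernel_basis_def)
    moreover have "increment (E i) (j i) \<subseteq> ?D i" "increment (E i) (j' i) \<subseteq> ?D i" for i
      using increment_subset[of "E i"] lift_Suc_mono_le[of "E i", OF E(2)]
      by (meson max.cobounded1 max.cobounded2 subset_trans)+
    then have "k \<in> Pi\<^sub>E UNIV ?D" "k' \<in> Pi\<^sub>E UNIV ?D"
      using j by (auto simp: D_def PiE_iff subset_iff)
    ultimately show ?thesis by (intro orthonormal_tens)
  qed
  moreover have "independent (tens ` (\<Union>j\<in>?S. D j))"
  proof (rule pairwise_orthogonal_independent)
    show "pairwise orthogonal (tens ` (\<Union>j\<in>?S. D j))"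
      unfolding pairwise_def orthogonal_def
    proof (intro ballI impI)
      fix x y assume "x \<in> tens ` (\<Union>j\<in>?S. D j)" "y \<in> tens ` (\<Union>j\<in>?S. D j)" "x \<noteq> y"
      then obtain k k' where k: "k \<in> (\<Union>j\<in>?S. D j)" "k' \<in> (\<Union>j\<in>?S. D j)"
        "x = tens k" "y = tens k'" by (elim imageE)
      with \<open>x \<noteq> y\<close> ortho[OF k(1,2)] show "x \<bullet> y = 0" by auto
    qed
    show "0 \<notin> tens ` (\<Union>j\<in>?S. D j)"
    proof
      assume "0 \<in> tens ` (\<Union>j\<in>?S. D j)"
      then obtain k where k: "k \<in> (\<Union>j\<in>?S. D j)" "tens k = 0" by force
      from ortho[OF k(1,1)] k(2) show False by simp
    qed
  qed
  moreover have "inj_on tens (\<Union>j\<in>?S. D j)"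
  proof (rule inj_onI, rule ccontr)
    fix k k' assume k: "k \<in> (\<Union>j\<in>?S. D j)" "k' \<in> (\<Union>j\<in>?S. D j)" "tens k = tens k'" "k \<noteq> k'"
    from ortho[OF k(1,1)] ortho[OF k(1,2)] k(3,4) show False by simp
  qed
  ultimately have "dim (sparse_tensor_space \<Omega> H ip \<kappa> X tens w J) = card (\<Union>j\<in>?S. D j)"
    by (simp only: dim_span_eq_card_independent card_image not_False_eq_True)
  also have "\<dots> = (\<Sum>j\<in>?S. card (D j))"
  proof (rule card_UN_disjoint)
    show "finite ?S" by (rule finite_weighted_simplex[of "($) w", OF w])
    show "\<forall>j\<in>?S. finite (D j)" using incr by (auto simp: D_def intro: finite_PiE)
    show "\<forall>j\<in>?S. \<forall>j'\<in>?S. j \<noteq> j' \<longrightarrow> D j \<inter> D j' = {}"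
    proof (intro ballI impI)
      fix j j' :: "'m \<Rightarrow> nat" assume "j \<noteq> j'"
      then obtain i where "j i \<noteq> j' i" by auto
      from increment_disjoint[of "E i", OF E(2) this] show "D j \<inter> D j' = {}"
        by (auto simp: D_def PiE_iff)
    qed
  qed
  also have "\<dots> = (\<Sum>j\<in>?S. \<Prod>i\<in>UNIV. card (increment (E i) (j i)))"
    by (simp add: D_def card_PiE)
  finally show ?thesis .
qed

section \<open>Number of data sites\<close>

lemma coordinate_le_edist: "k < d \<Longrightarrow> \<bar>x k - y k\<bar> \<le> edist d x y"
  unfolding edist_def using member_le_L2_set[of "{..<d}" k "\<lambda>k. \<bar>x k - y k\<bar>"]
  by (simp add: L2_set_def)

lemma edist_le_sum: "edist d x y \<le> (\<Sum>k<d. \<bar>x k - y k\<bar>)"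
  unfolding edist_def by (rule L2_set_le_sum_abs)

text \<open>
  Cut space into cubes of side \<open>q / d\<close>.  Two points in the same cube have distance less than
  \<open>q\<close>, so each cube contains at most one point of \<open>X\<close>; it remains to count the cubes that meet
  the box of half-width \<open>B\<close>.
\<close>

lemma card_separated_le:
  assumes d: "d \<ge> 1" and q: "q > 0"
    and bound: "\<And>x k. x \<in> X \<Longrightarrow> k < d \<Longrightarrow> \<bar>x k\<bar> \<le> B"
    and sep: "\<And>x y. x \<in> X \<Longrightarrow> y \<in> X \<Longrightarrow> x \<noteq> y \<Longrightarrow> q \<le> edist d x y"
    and B: "B \<ge> 0"
  shows "real (card X) \<le> (2 * B * real d / q + 3) ^ d"
proof -
  define N where "N = \<lceil>B * real d / q\<rceil>"
  define g where "g x = (\<lambda>k\<in>{..<d}. \<lfloor>x k * real d / q\<rfloor>)" for x :: point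
  have "0 \<le> B * real d / q" using B q by simp
  then have N: "N \<ge> 0" unfolding N_def by linarith
  have "inj_on g X"
  proof (rule inj_onI, rule ccontr)
    fix x y assume xy: "x \<in> X" "y \<in> X" "g x = g y" "x \<noteq> y"
    have "\<bar>x k - y k\<bar> < q / real d" if "k < d" for k
    proof -
      have "\<lfloor>x k * real d / q\<rfloor> = \<lfloor>y k * real d / q\<rfloor>"
        using fun_cong[OF xy(3), of k] that by (simp add: g_def)
      then have "\<bar>x k * real d / q - y k * real d / q\<bar> < 1" by linarith
      also have "x k * real d / q - y k * real d / q = (x k - y k) * (real d / q)"
        by (simp add: field_simps)
      finally have "\<bar>x k - y k\<bar> * (real d / q) < 1" using q by (simp add: abs_mult)
      then show ?thesis using q d by (simp add: field_simps)
    qed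
    then have "(\<Sum>k<d. \<bar>x k - y k\<bar>) < (\<Sum>k<d. q / real d)"
      using d by (intro sum_strict_mono) (auto simp: lessThan_empty_iff)
    also have "\<dots> = q" using d by simp
    finally show False using sep[OF xy(1,2,4)] edist_le_sum[of d x y] by linarith
  qed
  moreover have sub: "g ` X \<subseteq> Pi\<^sub>E {..<d} (\<lambda>_. {- N..N})"
  proof (intro image_subsetI PiE_I)
    fix x k assume x: "x \<in> X" "k \<in> {..<d}"
    have "\<bar>x k * real d / q\<bar> = \<bar>x k\<bar> * (real d / q)" using q by (simp add: abs_mult)
    also have "\<dots> \<le> B * (real d / q)"
      using bound[of x k] x q by (intro mult_right_mono) auto
    also have "\<dots> \<le> real_of_int N" unfolding N_def by simp
    finally have "\<bar>x k * real d / q\<bar> \<le> real_of_int N" .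
    then have "- N \<le> \<lfloor>x k * real d / q\<rfloor>" "\<lfloor>x k * real d / q\<rfloor> \<le> N" by linarith+
    then show "g x k \<in> {- N..N}" using x by (simp add: g_def)
  qed (simp add: g_def)
  ultimately have "card X \<le> card (Pi\<^sub>E {..<d} (\<lambda>_. {- N..N}))"
    by (metis card_image card_mono finite_PiE finite_atLeastAtMost_int finite_lessThan)
  then have "real (card X) \<le> real (card (Pi\<^sub>E {..<d} (\<lambda>_. {- N..N})))" by simp
  also have "\<dots> = real_of_int (2 * N + 1) ^ d"
    using N by (simp add: card_PiE)
  also have "\<dots> \<le> (2 * B * real d / q + 3) ^ d"
  proof (rule power_mono)
    have "real_of_int N \<le> B * real d / q + 1" unfolding N_def by linarith
    then show "real_of_int (2 * N + 1) \<le> 2 * B * real d / q + 3" by simp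
  qed (use N in simp)
  finally show ?thesis .
qed

text \<open>
  Place a grid of spacing \<open>3 * h\<close> in a cube contained in \<open>\<Omega>\<close>.  Every grid point has a site
  within distance \<open>h\<close>, and no site can serve two grid points.
\<close>

lemma card_covering_ge:
  assumes h: "h > 0" and r: "r > 0" and X: "finite X"
    and cube: "\<And>x. x \<in> rspace d \<Longrightarrow> (\<And>k. k < d \<Longrightarrow> \<bar>x k - z k\<bar> < r) \<Longrightarrow> x \<in> \<Omega>"
    and cover: "\<And>x. x \<in> \<Omega> \<Longrightarrow> \<exists>y\<in>X. edist d x y \<le> h"
  shows "(r / (3 * h)) ^ d \<le> real (card X)"
proof -
  define M where "M = nat \<lceil>r / (3 * h)\<rceil>"
  define p where "p a = (\<lambda>k\<in>{..<d}. z k + 3 * h * real (a k))" for a :: "nat \<Rightarrow> nat"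
  let ?A = "Pi\<^sub>E {..<d} (\<lambda>_. {..<M})"
  have "\<exists>y\<in>X. edist d (p a) y \<le> h" if a: "a \<in> ?A" for a
  proof (rule cover, rule cube)
    show "p a \<in> rspace d" by (simp add: p_def rspace_def)
    fix k assume k: "k < d"
    then have "a k < M" using a by (auto simp: PiE_iff)
    then have "real (a k) < r / (3 * h)" unfolding M_def by linarith
    then have "3 * h * real (a k) < r" using h by (simp add: field_simps)
    then show "\<bar>p a k - z k\<bar> < r" using k h by (simp add: p_def abs_mult)
  qed
  then obtain y where y: "\<And>a. a \<in> ?A \<Longrightarrow> y a \<in> X" "\<And>a. a \<in> ?A \<Longrightarrow> edist d (p a) (y a) \<le> h"
    by metis
  have "inj_on y ?A"
  proof (rule inj_onI)
    fix a b assume ab: "a \<in> ?A" "b \<in> ?A" "y a = y b"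
    show "a = b"
    proof (rule PiE_ext[OF ab(1,2)])
      fix k assume k: "k \<in> {..<d}"
      have "\<bar>p a k - y a k\<bar> \<le> h" "\<bar>p b k - y a k\<bar> \<le> h"
        using k y(2)[OF ab(1)] y(2)[OF ab(2)] ab(3) coordinate_le_edist[of k d "p a" "y a"]
          coordinate_le_edist[of k d "p b" "y a"] by auto
      then have "\<bar>p a k - p b k\<bar> \<le> 2 * h" by linarith
      moreover have "p a k - p b k = 3 * h * (real (a k) - real (b k))"
        using k by (simp add: p_def algebra_simps)
      ultimately have "3 * h * \<bar>real (a k) - real (b k)\<bar> \<le> 2 * h" using h by (simp add: abs_mult)
      then have "\<bar>real (a k) - real (b k)\<bar> < 1" using h by (simp add: field_simps)
      then show "a k = b k" by linarith
    qed
  qed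
  then have "card ?A \<le> card X" using y(1) X by (intro card_inj_on_le) auto
  then have "real M ^ d \<le> real (card X)" by (simp add: card_PiE flip: of_nat_power)
  moreover have "(r / (3 * h)) ^ d \<le> real M ^ d"
    using h r real_nat_ceiling_ge[of "r / (3 * h)"] by (intro power_mono) (simp_all add: M_def)
  ultimately show ?thesis by linarith
qed

lemma open_domain_contains_cube:
  assumes "openin (top_of_set (rspace d)) \<Omega>" "z \<in> \<Omega>"
  shows "\<exists>r>0. \<forall>x\<in>rspace d. (\<forall>k<d. \<bar>x k - z k\<bar> < r) \<longrightarrow> x \<in> \<Omega>"
proof -
  obtain U where U: "open U" "\<Omega> = rspace d \<inter> U" using assms(1) by (auto simp: openin_open)
  have "openin (product_topology (\<lambda>i. euclidean) UNIV) U" "z \<in> U"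
    using U assms(2) by (auto simp: open_fun_def)
  from product_topology_open_contains_basis[OF this]
  obtain V where V: "z \<in> Pi\<^sub>E UNIV V" "\<And>i. open (V i)" "Pi\<^sub>E UNIV V \<subseteq> U"
    by (auto simp flip: open_openin)
  have "\<exists>r. r > 0 \<and> ball (z k) r \<subseteq> V k" for k
    using V(1) V(2)[of k] open_contains_ball by (metis PiE_mem UNIV_I)
  then obtain f where f: "\<And>k. f k > 0" "\<And>k. ball (z k) (f k) \<subseteq> V k" by metis
  define r where "r = Min (insert 1 (f ` {..<d}))"
  have "r > 0" using f(1) by (simp add: r_def)
  moreover have "x \<in> \<Omega>" if x: "x \<in> rspace d" "\<forall>k<d. \<bar>x k - z k\<bar> < r" for x
  proof -
    have "x k \<in> V k" for k
    proof (cases "k < d")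
      case True
      then have "r \<le> f k" by (auto simp: r_def)
      then have "x k \<in> ball (z k) (f k)" using x(2) True by (force simp: dist_real_def)
      then show ?thesis using f(2) by blast
    next
      case False
      then have "x k = z k"
        using x(1) U(2) assms(2) by (auto simp: rspace_def PiE_def extensional_def)
      then show ?thesis using V(1) by (auto simp: PiE_iff)
    qed
    then have "x \<in> U" using V(3) by (auto simp: PiE_iff)
    then show ?thesis using U(2) x(1) by blast
  qed
  ultimately show ?thesis by blast
qed

text \<open>
  The bound on \<open>\<Omega>\<close> makes the set of minimal distances bounded above, so that its supremum is
  an upper bound; the minimum over the finite set \<open>X\<close> is attained.
\<close>

lemma fill_distance_cover:
  assumes bound: "\<And>x k. x \<in> \<Omega> \<Longrightarrow> k < d \<Longrightarrow> \<bar>x k\<bar> \<le> B"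
    and X: "finite X" "X \<noteq> {}" "X \<subseteq> \<Omega>" and x: "x \<in> \<Omega>"
  shows "\<exists>y\<in>X. edist d x y \<le> fill_distance d X \<Omega>"
proof -
  let ?m = "\<lambda>x. Min ((\<lambda>y. edist d x y) ` X)"
  have "bdd_above (?m ` \<Omega>)"
  proof (rule bdd_aboveI2)
    fix u assume u: "u \<in> \<Omega>"
    obtain y where y: "y \<in> X" using X by blast
    have "?m u \<le> edist d u y" using X y by (intro Min_le) auto
    also have "\<dots> \<le> (\<Sum>k<d. \<bar>u k - y k\<bar>)" by (rule edist_le_sum)
    also have "\<dots> \<le> (\<Sum>k<d. 2 * B)"
    proof (rule sum_mono)
      fix k assume "k \<in> {..<d}"
      then show "\<bar>u k - y k\<bar> \<le> 2 * B" using bound[of u k] bound[of y k] u y X by fastforce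
    qed
    finally show "?m u \<le> (\<Sum>k<d. 2 * B)" .
  qed
  then have "?m x \<le> fill_distance d X \<Omega>"
    unfolding fill_distance_def using x by (intro cSUP_upper)
  moreover have "?m x \<in> (\<lambda>y. edist d x y) ` X" using X by (intro Min_in) auto
  ultimately show ?thesis by auto
qed

lemma separation_distance_le:
  assumes "finite X" "x \<in> X" "y \<in> X" "x \<noteq> y"
  shows "separation_distance d X \<le> edist d x y"
proof -
  have "{edist d x y |x y. x \<in> X \<and> y \<in> X \<and> x \<noteq> y} \<subseteq> (\<lambda>(x, y). edist d x y) ` (X \<times> X)" by auto
  then have "finite {edist d x y |x y. x \<in> X \<and> y \<in> X \<and> x \<noteq> y}"
    by (rule finite_subset) (use assms(1) in simp)
  then show ?thesis unfolding separation_distance_def using assms by (intro Min_le) auto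
qed

text \<open>
  The fill distance is at most a multiple of \<open>2 powr - j\<close>, which bounds the number of sites from
  below by covering; by quasi-uniformity the separation distance is at least a multiple of
  \<open>2 powr - j\<close>, which bounds it from above by packing.  The packing argument needs two sites; a
  single site satisfies the upper bound trivially.
\<close>

lemma card_data_sites:
  assumes d: "d \<ge> 1" and dom: "bounded_lipschitz_domain d \<Omega>" and sites: "data_sites d \<Omega> X"
  shows "\<exists>c>0. \<exists>C. \<forall>j. c * 2 ^ (d * j) \<le> real (card (X j)) \<and> real (card (X j)) \<le> C * 2 ^ (d * j)"
proof -
  obtain B where B: "\<And>x. x \<in> \<Omega> \<Longrightarrow> enorm d x \<le> B"
    using dom unfolding bounded_lipschitz_domain_def by blast
  obtain z where z: "z \<in> \<Omega>" using dom by (auto simp: bounded_lipschitz_domain_def)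
  have bound: "\<bar>x k\<bar> \<le> B" if "x \<in> \<Omega>" "k < d" for x k
    using member_le_L2_set[of "{..<d}" k "\<lambda>k. \<bar>x k\<bar>"] B[OF that(1)] that(2)
    by (simp add: enorm_def L2_set_def)
  have B0: "B \<ge> 0" using bound[OF z, of 0] d by linarith
  obtain r where r: "r > 0" "\<And>x. x \<in> rspace d \<Longrightarrow> (\<And>k. k < d \<Longrightarrow> \<bar>x k - z k\<bar> < r) \<Longrightarrow> x \<in> \<Omega>"
    using open_domain_contains_cube[of d \<Omega> z] dom z
    unfolding bounded_lipschitz_domain_def by metis
  have X: "finite (X j)" "X j \<noteq> {}" "X j \<subseteq> \<Omega>" for j
    using sites by (auto simp: data_sites_def)
  let ?h = "\<lambda>j. fill_distance d (X j) \<Omega>"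
  obtain C1 where C1: "C1 > 0" "\<And>j. ?h j \<le> C1 * 2 powr (- real j)"
    using sites by (auto simp: data_sites_def sim_on_def lesssim_on_def)
  obtain C2 where C2: "C2 > 0" "\<And>j. 2 powr (- real j) \<le> C2 * ?h j"
    using sites by (auto simp: data_sites_def sim_on_def lesssim_on_def)
  obtain c3 where c3: "c3 > 0" "\<And>j. card (X j) \<ge> 2 \<Longrightarrow> ?h j \<le> c3 * separation_distance d (X j)"
    using sites by (auto simp: data_sites_def quasi_uniform_def)
  have p: "2 powr (- real j) = 1 / 2 ^ j" for j
    by (simp add: powr_minus powr_realpow divide_simps)
  have lower: "(r / (3 * C1)) ^ d * 2 ^ (d * j) \<le> real (card (X j))" for j
  proof -
    have "(r / (3 * (C1 * (1 / 2 ^ j)))) ^ d \<le> real (card (X j))"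
    proof (rule card_covering_ge[OF _ r(1) X(1) r(2)])
      show "0 < C1 * (1 / 2 ^ j)" using C1 by simp
      fix x assume "x \<in> \<Omega>"
      then have "\<exists>y\<in>X j. edist d x y \<le> ?h j"
        using bound X by (intro fill_distance_cover[where B = B]) auto
      then show "\<exists>y\<in>X j. edist d x y \<le> C1 * (1 / 2 ^ j)" using C1(2)[of j] unfolding p by force
    qed
    also have "(r / (3 * (C1 * (1 / 2 ^ j)))) ^ d = (r / (3 * C1)) ^ d * 2 ^ (d * j)"
      by (simp add: power_mult_distrib power_divide mult.commute[of d j] flip: power_mult)
    finally show ?thesis .
  qed
  \<comment> \<open>Two or more sites of level \<open>j\<close> are at least \<open>1 / (C2 * c3 * 2 ^ j)\<close> apart.\<close>
  define K where "K = 2 * B * real d * (C2 * c3) + 3"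
  have K: "K \<ge> 3" using B0 C2 c3 by (simp add: K_def)
  have upper: "real (card (X j)) \<le> K ^ d * 2 ^ (d * j)" for j
  proof -
    have "real (card (X j)) \<le> (K * 2 ^ j) ^ d"
    proof (cases "card (X j) \<ge> 2")
      case True
      let ?q = "1 / (C2 * c3 * 2 ^ j)"
      have "1 / 2 ^ j \<le> C2 * (c3 * separation_distance d (X j))"
        using C2(2)[of j] mult_left_mono[OF c3(2)[OF True], of C2] C2(1) unfolding p by linarith
      then have q: "?q \<le> separation_distance d (X j)"
        using C2 c3 by (simp add: field_simps)
      have "real (card (X j)) \<le> (2 * B * real d / ?q + 3) ^ d"
      proof (rule card_separated_le[OF d])
        show "0 < ?q" using C2 c3 by simp
        show "\<bar>x k\<bar> \<le> B" if "x \<in> X j" "k < d" for x k using bound X that by blast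
        show "?q \<le> edist d x y" if "x \<in> X j" "y \<in> X j" "x \<noteq> y" for x y
          using separation_distance_le[OF X(1) that, of d] q by linarith
      qed (rule B0)
      also have "\<dots> \<le> (K * 2 ^ j) ^ d"
      proof (rule power_mono)
        have "2 * B * real d / ?q + 3 = 2 * B * real d * (C2 * c3) * 2 ^ j + 3" by simp
        also have "\<dots> \<le> 2 * B * real d * (C2 * c3) * 2 ^ j + 3 * 2 ^ j" by simp
        also have "\<dots> = K * 2 ^ j" by (simp add: K_def algebra_simps)
        finally show "2 * B * real d / ?q + 3 \<le> K * 2 ^ j" .
        show "0 \<le> 2 * B * real d / ?q + 3" using B0 C2 c3 by simp
      qed
      finally show ?thesis .
    next
      case False
      have "1 \<le> K * 2 ^ j" using K mult_mono[of 1 K 1 "2 ^ j :: real"] by simp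
      then have "1 \<le> (K * 2 ^ j) ^ d" by (rule one_le_power)
      then show ?thesis using False by linarith
    qed
    also have "\<dots> = K ^ d * 2 ^ (d * j)"
      by (simp add: power_mult_distrib mult.commute[of d j] flip: power_mult)
    finally show ?thesis .
  qed
  have "(r / (3 * C1)) ^ d > 0" using r C1 by simp
  then show ?thesis using lower upper by blast
qed

section \<open>Weighted sums over a simplex\<close>

lemma finite_weighted_simplex_slice:
  fixes w :: "'m::finite \<Rightarrow> real"
  assumes w: "\<And>i. w i > 0"
  shows "finite {j \<in> extensional (- {i0}) :: ('m \<Rightarrow> nat) set. (\<Sum>i\<in>- {i0}. real (j i) * w i) \<le> t}"
    (is "finite ?S'")
proof (rule finite_surj[OF finite_weighted_simplex[OF w], of _ "\<lambda>j. restrict j (- {i0})"])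
  show "?S' \<subseteq> (\<lambda>j. restrict j (- {i0})) ` {j. (\<Sum>i\<in>UNIV. real (j i) * w i) \<le> t}"
  proof
    fix j assume j: "j \<in> ?S'"
    have "(\<Sum>i\<in>UNIV. real ((j(i0 := 0)) i) * w i) = (\<Sum>i\<in>- {i0}. real (j i) * w i)"
      by (rule sum.mono_neutral_cong_right) auto
    then have "j(i0 := 0) \<in> {j. (\<Sum>i\<in>UNIV. real (j i) * w i) \<le> t}"
      using j by (simp only: mem_Collect_eq)
    moreover have "j = restrict (j(i0 := 0)) (- {i0})"
      using j by (auto simp: fun_eq_iff extensional_def)
    ultimately show "j \<in> (\<lambda>j. restrict j (- {i0})) ` {j. (\<Sum>i\<in>UNIV. real (j i) * w i) \<le> t}"
      by blast
  qed
qed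

text \<open>
  Summing over the coordinate \<open>i0\<close> first.  For fixed other coordinates the admissible values of
  \<open>j i0\<close> form an initial segment, so only partial sums of \<open>n i0\<close> enter.
\<close>

lemma sum_simplex_slice:
  fixes w :: "'m::finite \<Rightarrow> real" and n :: "'m \<Rightarrow> nat \<Rightarrow> real"
  assumes w: "\<And>i. w i > 0"
  shows "(\<Sum>j\<in>{j. (\<Sum>i\<in>UNIV. real (j i) * w i) \<le> t}. \<Prod>i\<in>UNIV. n i (j i)) =
    (\<Sum>j\<in>{j \<in> extensional (- {i0}). (\<Sum>i\<in>- {i0}. real (j i) * w i) \<le> t}.
       (\<Prod>i\<in>- {i0}. n i (j i)) *
       (\<Sum>k\<le>nat \<lfloor>(t - (\<Sum>i\<in>- {i0}. real (j i) * w i)) / w i0\<rfloor>. n i0 k))"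
proof -
  let ?S = "{j. (\<Sum>i\<in>UNIV. real (j i) * w i) \<le> t}"
  let ?rest = "\<lambda>j. \<Sum>i\<in>- {i0}. real (j i) * w i"
  let ?S' = "{j \<in> extensional (- {i0}). ?rest j \<le> t}"
  let ?L = "\<lambda>j. nat \<lfloor>(t - ?rest j) / w i0\<rfloor>"
  have split: "(\<Sum>i\<in>UNIV. real (j i) * w i) = real (j i0) * w i0 + ?rest j" for j
    by (subst sum.remove[of UNIV i0]) (auto simp: Compl_eq_Diff_UNIV)
  have upd: "?rest (j(i0 := k)) = ?rest j" for j k
    by (intro sum.cong) auto
  have restr: "?rest (restrict j (- {i0})) = ?rest j" for j
    by (intro sum.cong) auto
  have L: "k \<le> ?L j \<longleftrightarrow> real k * w i0 + ?rest j \<le> t" if "?rest j \<le> t" for j k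
  proof -
    have "0 \<le> (t - ?rest j) / w i0" using that w[of i0] by simp
    then have "k \<le> ?L j \<longleftrightarrow> real k \<le> (t - ?rest j) / w i0"
      by (metis le_nat_floor le_nat_iff le_floor_iff of_int_of_nat_eq zero_le_floor)
    also have "\<dots> \<longleftrightarrow> real k * w i0 + ?rest j \<le> t"
      using w[of i0] by (auto simp: pos_le_divide_eq)
    finally show ?thesis .
  qed
  have fin: "finite ?S'" by (rule finite_weighted_simplex_slice[OF w])
  have "(\<Sum>j\<in>?S. \<Prod>i\<in>UNIV. n i (j i)) =
      (\<Sum>(j, k)\<in>Sigma ?S' (\<lambda>j. {..?L j}). (\<Prod>i\<in>- {i0}. n i (j i)) * n i0 k)"
  proof (rule sum.reindex_bij_witness[of _ "\<lambda>(j, k). j(i0 := k)" "\<lambda>j. (restrict j (- {i0}), j i0)"])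
    fix j assume j: "j \<in> ?S"
    show "(case (restrict j (- {i0}), j i0) of (j, k) \<Rightarrow> j(i0 := k)) = j"
      by (auto simp: fun_eq_iff)
    have le: "real (j i0) * w i0 + ?rest j \<le> t" using j split by simp
    moreover have "0 \<le> real (j i0) * w i0" using w[of i0] by simp
    ultimately have "?rest j \<le> t" by linarith
    then show "(restrict j (- {i0}), j i0) \<in> Sigma ?S' (\<lambda>j. {..?L j})"
      using L[of "restrict j (- {i0})" "j i0"] le unfolding mem_Sigma_iff mem_Collect_eq restr
      by simp
    have "(\<Prod>i\<in>- {i0}. n i (restrict j (- {i0}) i)) = (\<Prod>i\<in>- {i0}. n i (j i))"
      by (intro prod.cong) auto
    then show "(case (restrict j (- {i0}), j i0) of (j, k) \<Rightarrow> (\<Prod>i\<in>- {i0}. n i (j i)) * n i0 k) =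
        (\<Prod>i\<in>UNIV. n i (j i))"
      by (subst prod.remove[of UNIV i0]) (auto simp: Compl_eq_Diff_UNIV)
  next
    fix p assume "p \<in> Sigma ?S' (\<lambda>j. {..?L j})"
    then obtain j k where p: "p = (j, k)" "j \<in> extensional (- {i0})" "?rest j \<le> t" "k \<le> ?L j"
      by auto
    have j: "restrict (j(i0 := k)) (- {i0}) = j"
      using p(2) by (auto simp: fun_eq_iff extensional_def)
    then show "(restrict (case p of (j, k) \<Rightarrow> j(i0 := k)) (- {i0}), (case p of (j, k) \<Rightarrow> j(i0 := k)) i0) = p"
      by (simp add: p(1))
    have "(\<Sum>i\<in>UNIV. real ((j(i0 := k)) i) * w i) \<le> t"
      using L[OF p(3)] p(4) unfolding split upd by simp
    then show "(case p of (j, k) \<Rightarrow> j(i0 := k)) \<in> ?S" by (simp only: p(1) split_conv mem_Collect_eq)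
  qed
  also have "\<dots> = (\<Sum>j\<in>?S'. \<Sum>k\<le>?L j. (\<Prod>i\<in>- {i0}. n i (j i)) * n i0 k)"
    by (subst sum.Sigma[OF fin]) auto
  finally show ?thesis by (simp add: sum_distrib_left)
qed

text \<open>
  Summation by parts: the hypothesis controls the partial sums of \<open>n\<close> but no individual term,
  which may vanish.  Each partial sum contributes at least \<open>c * (1 - 1 / 2 ^ d)\<close>, hence at
  least \<open>c / 2\<close>.
\<close>

lemma discounted_sum_ge:
  fixes n :: "nat \<Rightarrow> real"
  assumes d: "d \<ge> 1" and c: "c > 0" and lower: "\<And>k. c * 2 ^ (d * k) \<le> (\<Sum>l\<le>k. n l)"
  shows "c / 2 * (real M + 1) \<le> (\<Sum>k\<le>M. n k / 2 ^ (d * k))"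
proof -
  \<comment> \<open>The extra first summand on the left is the boundary term and makes the induction work.\<close>
  have "(\<Sum>l\<le>M. n l) / 2 ^ (d * M) + c * real M / 2 \<le> (\<Sum>k\<le>M. n k / 2 ^ (d * k))"
  proof (induction M)
    case 0
    then show ?case by simp
  next
    case (Suc M)
    let ?N = "\<Sum>l\<le>M. n l"
    have "c \<le> ?N / 2 ^ (d * M)" using lower[of M] by (simp add: field_simps)
    moreover have "(1::real) / 2 ^ d \<le> 1 / 2"
      using d power_increasing[of 1 d "2::real"] by (simp add: field_simps)
    ultimately have "c * (1 / 2) \<le> ?N / 2 ^ (d * M) * (1 - 1 / 2 ^ d)"
      using c by (intro mult_mono) auto
    also have "\<dots> = ?N / 2 ^ (d * M) - ?N / 2 ^ (d * Suc M)"
      by (simp add: power_add field_simps)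
    finally have "c / 2 \<le> ?N / 2 ^ (d * M) - ?N / 2 ^ (d * Suc M)" by simp
    moreover have "(\<Sum>l\<le>Suc M. n l) / 2 ^ (d * Suc M) =
        ?N / 2 ^ (d * Suc M) + n (Suc M) / 2 ^ (d * Suc M)"
      by (simp add: add_divide_distrib)
    moreover have "c * real (Suc M) / 2 = c * real M / 2 + c / 2" by (simp add: field_simps)
    ultimately show ?case using Suc unfolding sum.atMost_Suc by linarith
  qed
  moreover have "c \<le> (\<Sum>l\<le>M. n l) / 2 ^ (d * M)" using lower[of M] by (simp add: field_simps)
  moreover have "c / 2 * (real M + 1) = c * real M / 2 + c / 2" by (simp add: field_simps)
  ultimately show ?thesis using c by linarith
qed

lemma prod_indexed_growth:
  fixes I :: "'m::finite set" and t :: real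
  shows "(\<Prod>i\<in>A. K i * (if i \<in> I then t else 1)) = (\<Prod>i\<in>A. K i) * t ^ card (A \<inter> I)"
  by (simp add: prod.distrib prod.If_cases)

text \<open>
  Let \<open>i0\<close> attain the maximum \<open>\<rho>\<close>, so that \<open>d i0 = \<rho> * w i0\<close>.  By the previous slicing, the sum over
  \<open>j i0\<close> is comparable to \<open>2 powr (\<rho> * (J - rest))\<close>, where \<open>rest\<close> is the weighted sum of the other
  coordinates.  This produces the factor \<open>2 powr (J * \<rho>)\<close> and leaves a sum of products of
  \<open>a i k = n i k * 2 powr (- \<rho> * w i * k)\<close> over a simplex in the other coordinates.

  The remaining sum is squeezed between sums over boxes, which factorize.  If \<open>i\<close> attains the
  maximum, the sums of \<open>a i\<close> grow linearly in the side length, which is proportional to \<open>J\<close>; there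
  are \<open>R - 1\<close> such indices besides \<open>i0\<close>.  Otherwise \<open>a i\<close> decays geometrically and contributes
  only a constant.
\<close>

lemma weighted_simplex_sum_asymptotics:
  fixes d :: "'m::finite \<Rightarrow> nat" and w :: "'m \<Rightarrow> real" and n :: "'m \<Rightarrow> nat \<Rightarrow> real"
  assumes d: "\<And>i. d i \<ge> 1" and w: "\<And>i. w i > 0" and n: "\<And>i k. n i k \<ge> 0"
    and growth: "\<And>i. \<exists>c>0. \<exists>C. \<forall>k. c * 2 ^ (d i * k) \<le> (\<Sum>l\<le>k. n i l) \<and> (\<Sum>l\<le>k. n i l) \<le> C * 2 ^ (d i * k)"
  defines "\<rho> \<equiv> Max (range (\<lambda>i. real (d i) / w i))"
  defines "R \<equiv> card {i. real (d i) / w i = \<rho>}"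
  shows "sim_on {J::nat. J \<ge> 1}
    (\<lambda>J. \<Sum>j\<in>{j. (\<Sum>i\<in>UNIV. real (j i) * w i) \<le> real J}. \<Prod>i\<in>UNIV. n i (j i))
    (\<lambda>J. 2 powr (real J * \<rho>) * real J ^ (R - 1))"
proof -
  define I where "I = {i. real (d i) / w i = \<rho>}"
  have "\<rho> \<in> range (\<lambda>i. real (d i) / w i)" unfolding \<rho>_def by (intro Max_in) auto
  then obtain i0 where i0: "\<rho> = real (d i0) / w i0" by auto
  have \<rho>_pos: "\<rho> > 0" using i0 d[of i0] w[of i0] by simp
  have le_\<rho>: "real (d i) \<le> \<rho> * w i" for i
  proof -
    have "real (d i) / w i \<le> \<rho>" unfolding \<rho>_def by (intro Max_ge) auto
    then show ?thesis using w[of i] by (simp add: field_simps)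
  qed
  have I: "i \<in> I \<longleftrightarrow> real (d i) = \<rho> * w i" for i using w[of i] by (auto simp: I_def field_simps)
  have card_I: "card (- {i0} \<inter> I) = R - 1"
  proof -
    have "- {i0} \<inter> I = I - {i0}" "i0 \<in> I" using i0 by (auto simp: I_def)
    then show ?thesis by (simp add: R_def I_def)
  qed
  obtain c where c: "\<And>i. c i > 0" "\<And>i k. c i * 2 ^ (d i * k) \<le> (\<Sum>l\<le>k. n i l)"
    using growth by metis
  obtain C where C: "\<And>i k. (\<Sum>l\<le>k. n i l) \<le> C i * 2 ^ (d i * k)"
    using growth by metis
  have C_pos: "C i > 0" for i using c(1)[of i] c(2)[of i 0] C[of i 0] by simp
  have n_le: "n i k \<le> C i * 2 ^ (d i * k)" for i k
    using C[of i k] member_le_sum[of k "{..k}" "n i"] n by force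
  \<comment> \<open>The counts discounted at the maximal rate \<open>\<rho>\<close>.\<close>
  define a where "a i k = n i k * 2 powr (- (\<rho> * w i * real k))" for i k
  have a0: "a i k \<ge> 0" for i k using n by (simp add: a_def)
  have a_I: "a i k = n i k / 2 ^ (d i * k)" if "i \<in> I" for i k
  proof -
    have "\<rho> * w i * real k = real (d i * k)" using that I by simp
    then show ?thesis by (simp only: a_def powr_minus powr_realpow[of 2] divide_inverse)
  qed
  let ?rest = "\<lambda>j. \<Sum>i\<in>- {i0}. real (j i) * w i"
  let ?S' = "\<lambda>J. {j \<in> extensional (- {i0}). ?rest j \<le> real J}"
  let ?f = "\<lambda>J::nat. \<Sum>j\<in>{j. (\<Sum>i\<in>UNIV. real (j i) * w i) \<le> real J}. \<Prod>i\<in>UNIV. n i (j i)"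
  let ?g = "\<lambda>J. \<Sum>j\<in>?S' J. \<Prod>i\<in>- {i0}. a i (j i)"
  define b where "b J j = (\<Prod>i\<in>- {i0}. n i (j i)) * (\<Sum>k\<le>nat \<lfloor>(real J - ?rest j) / w i0\<rfloor>. n i0 k)"
    for J :: nat and j
  have f_eq: "?f J = sum (b J) (?S' J)" for J
    unfolding b_def by (rule sum_simplex_slice[OF w])
  have prod_a: "2 powr (real J * \<rho>) * (\<Prod>i\<in>- {i0}. a i (j i)) =
      (\<Prod>i\<in>- {i0}. n i (j i)) * 2 powr (\<rho> * (real J - ?rest j))" for J :: nat and j
  proof -
    have "(\<Prod>i\<in>- {i0}. a i (j i)) =
        (\<Prod>i\<in>- {i0}. n i (j i)) * 2 powr (\<Sum>i\<in>- {i0}. - (\<rho> * w i * real (j i)))"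
      unfolding a_def prod.distrib by (simp add: powr_sum)
    also have "(\<Sum>i\<in>- {i0}. - (\<rho> * w i * real (j i))) = - (\<rho> * ?rest j)"
      by (simp add: sum_negf sum_distrib_left ac_simps)
    finally have "2 powr (real J * \<rho>) * (\<Prod>i\<in>- {i0}. a i (j i)) =
        (\<Prod>i\<in>- {i0}. n i (j i)) * (2 powr (real J * \<rho>) * 2 powr (- (\<rho> * ?rest j)))"
      by simp
    also have "2 powr (real J * \<rho>) * 2 powr (- (\<rho> * ?rest j)) = 2 powr (\<rho> * (real J - ?rest j))"
      by (simp add: algebra_simps flip: powr_add)
    finally show ?thesis .
  qed
  have last: "c i0 / 2 ^ d i0 * 2 powr (\<rho> * t) \<le> (\<Sum>k\<le>nat \<lfloor>t / w i0\<rfloor>. n i0 k)"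
    "(\<Sum>k\<le>nat \<lfloor>t / w i0\<rfloor>. n i0 k) \<le> C i0 * 2 powr (\<rho> * t)" if t: "t \<ge> 0" for t
  proof -
    define L where "L = nat \<lfloor>t / w i0\<rfloor>"
    have "0 \<le> t / w i0" using t w[of i0] by simp
    then have L: "real L \<le> t / w i0" "t / w i0 \<le> real L + 1" unfolding L_def by linarith+
    have \<rho>t: "\<rho> * t = real (d i0) * (t / w i0)" by (simp add: i0)
    have p: "2 ^ (d i0 * L) = 2 powr (real (d i0) * real L)"
      by (simp flip: powr_realpow)
    have "2 powr (\<rho> * t) \<le> 2 powr (real (d i0) * (real L + 1))"
      unfolding \<rho>t using L by (intro powr_mono mult_left_mono) auto
    also have "\<dots> = 2 ^ d i0 * 2 ^ (d i0 * L)"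
      by (simp add: p distrib_left powr_add powr_realpow)
    finally have "2 powr (\<rho> * t) / 2 ^ d i0 \<le> 2 ^ (d i0 * L)" by (simp add: field_simps)
    then have "c i0 * (2 powr (\<rho> * t) / 2 ^ d i0) \<le> c i0 * 2 ^ (d i0 * L)"
      using c(1)[of i0] by (intro mult_left_mono) auto
    then show "c i0 / 2 ^ d i0 * 2 powr (\<rho> * t) \<le> (\<Sum>k\<le>nat \<lfloor>t / w i0\<rfloor>. n i0 k)"
      using c(2)[of i0 L] by (simp add: L_def)
    have "2 ^ (d i0 * L) \<le> 2 powr (\<rho> * t)"
      unfolding p \<rho>t using L by (intro powr_mono mult_left_mono) auto
    then have "C i0 * 2 ^ (d i0 * L) \<le> C i0 * 2 powr (\<rho> * t)"
      using C_pos[of i0] by (intro mult_left_mono) auto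
    then show "(\<Sum>k\<le>nat \<lfloor>t / w i0\<rfloor>. n i0 k) \<le> C i0 * 2 powr (\<rho> * t)"
      using C[of i0 L] by (simp add: L_def)
  qed
  have f_le: "?f J \<le> C i0 * (2 powr (real J * \<rho>) * ?g J)" for J
  proof -
    have "b J j \<le> C i0 * (2 powr (real J * \<rho>) * (\<Prod>i\<in>- {i0}. a i (j i)))" if "j \<in> ?S' J" for j
      using mult_left_mono[OF last(2)[of "real J - ?rest j"], of "\<Prod>i\<in>- {i0}. n i (j i)"] that n
      unfolding prod_a b_def by (simp add: prod_nonneg ac_simps)
    then have "sum (b J) (?S' J) \<le> (\<Sum>j\<in>?S' J. C i0 * (2 powr (real J * \<rho>) * (\<Prod>i\<in>- {i0}. a i (j i))))"
      by (rule sum_mono)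
    then show ?thesis unfolding f_eq by (simp add: sum_distrib_left)
  qed
  have f_ge: "c i0 / 2 ^ d i0 * (2 powr (real J * \<rho>) * ?g J) \<le> ?f J" for J
  proof -
    have "c i0 / 2 ^ d i0 * (2 powr (real J * \<rho>) * (\<Prod>i\<in>- {i0}. a i (j i))) \<le> b J j"
      if "j \<in> ?S' J" for j
      using mult_left_mono[OF last(1)[of "real J - ?rest j"], of "\<Prod>i\<in>- {i0}. n i (j i)"] that n
      unfolding prod_a b_def by (simp add: prod_nonneg ac_simps)
    then have "(\<Sum>j\<in>?S' J. c i0 / 2 ^ d i0 * (2 powr (real J * \<rho>) * (\<Prod>i\<in>- {i0}. a i (j i)))) \<le> sum (b J) (?S' J)"
      by (rule sum_mono)
    then show ?thesis unfolding f_eq by (simp add: sum_distrib_left)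
  qed
  let ?J = "\<lambda>i J. if i \<in> I then real J else 1"
  have "\<exists>K>0. \<forall>J::nat. J \<ge> 1 \<longrightarrow> (\<Sum>k\<le>nat \<lfloor>real J / w i\<rfloor>. a i k) \<le> K * ?J i J" for i
  proof (cases "i \<in> I")
    case True
    have "(\<Sum>k\<le>nat \<lfloor>real J / w i\<rfloor>. a i k) \<le> C i * (1 / w i + 1) * real J" if J: "J \<ge> 1" for J :: nat
    proof -
      have "(\<Sum>k\<le>nat \<lfloor>real J / w i\<rfloor>. a i k) \<le> (\<Sum>k\<le>nat \<lfloor>real J / w i\<rfloor>. C i)"
        using n_le by (intro sum_mono) (simp add: a_I[OF True] field_simps)
      also have "\<dots> = C i * (real (nat \<lfloor>real J / w i\<rfloor>) + 1)" by simp
      also have "\<dots> \<le> C i * (real J / w i + real J)"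
      proof (rule mult_left_mono)
        have "0 \<le> real J / w i" using w[of i] by simp
        then have "real (nat \<lfloor>real J / w i\<rfloor>) \<le> real J / w i" by linarith
        then show "real (nat \<lfloor>real J / w i\<rfloor>) + 1 \<le> real J / w i + real J" using J by linarith
      qed (use C_pos[of i] in simp)
      finally show ?thesis by (simp add: algebra_simps)
    qed
    moreover have "C i * (1 / w i + 1) > 0" using C_pos[of i] w[of i] by (simp add: add_pos_pos)
    ultimately show ?thesis using True by auto
  next
    case False
    define q where "q = 2 powr (real (d i) - \<rho> * w i)"
    have "real (d i) - \<rho> * w i < 0" using False I[of i] le_\<rho>[of i] by linarith
    then have q: "0 < q" "q < 1" by (auto simp: q_def powr_less_one)
    have "(\<Sum>k\<le>M. a i k) \<le> C i * (1 / (1 - q))" for M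
    proof -
      have "a i k \<le> C i * q ^ k" for k
      proof -
        have "a i k \<le> C i * 2 ^ (d i * k) * 2 powr (- (\<rho> * w i * real k))"
          unfolding a_def using n_le by (intro mult_right_mono) auto
        also have "2 ^ (d i * k) = 2 powr (real (d i) * real k)" by (simp flip: powr_realpow)
        also have "C i * 2 powr (real (d i) * real k) * 2 powr (- (\<rho> * w i * real k)) =
            C i * 2 powr ((real (d i) - \<rho> * w i) * real k)"
          by (simp add: algebra_simps flip: powr_add)
        also have "2 powr ((real (d i) - \<rho> * w i) * real k) = q ^ k"
          using q by (simp add: q_def powr_powr flip: powr_realpow)
        finally show ?thesis .
      qed
      then have "(\<Sum>k\<le>M. a i k) \<le> C i * (\<Sum>k\<le>M. q ^ k)"
        unfolding sum_distrib_left by (rule sum_mono)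
      also have "(\<Sum>k\<le>M. q ^ k) \<le> 1 / (1 - q)"
        using q by (simp add: sum_gp0 divide_right_mono)
      finally show ?thesis using C_pos[of i] by (simp add: mult_left_mono)
    qed
    moreover have "C i * (1 / (1 - q)) > 0" using C_pos[of i] q by simp
    ultimately show ?thesis using False by auto
  qed
  then obtain K where K: "\<And>i. K i > 0"
    "\<And>i J. J \<ge> 1 \<Longrightarrow> (\<Sum>k\<le>nat \<lfloor>real J / w i\<rfloor>. a i k) \<le> K i * ?J i J" by metis
  have g_le: "?g J \<le> (\<Prod>i\<in>- {i0}. K i) * real J ^ (R - 1)" if J: "J \<ge> 1" for J :: nat
  proof -
    let ?B = "Pi\<^sub>E (- {i0}) (\<lambda>i. {..nat \<lfloor>real J / w i\<rfloor>})"
    have "?S' J \<subseteq> ?B"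
    proof (intro subsetI PiE_I)
      fix j i assume j: "j \<in> ?S' J" and i: "i \<in> - {i0}"
      have "real (j i) * w i \<le> ?rest j"
        using i by (intro member_le_sum mult_nonneg_nonneg less_imp_le[OF w]) auto
      then have "real (j i) \<le> real J / w i" using j w[of i] by (simp add: pos_le_divide_eq)
      then show "j i \<in> {..nat \<lfloor>real J / w i\<rfloor>}" by (simp add: le_nat_floor)
    qed (auto simp: extensional_def)
    then have "?g J \<le> (\<Sum>j\<in>?B. \<Prod>i\<in>- {i0}. a i (j i))"
      using a0 by (intro sum_mono2 finite_PiE prod_nonneg) auto
    also have "\<dots> = (\<Prod>i\<in>- {i0}. \<Sum>k\<le>nat \<lfloor>real J / w i\<rfloor>. a i k)"
      by (rule prod_sum_PiE[symmetric]) auto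
    also have "\<dots> \<le> (\<Prod>i\<in>- {i0}. K i * ?J i J)"
      using K(2)[OF J] a0 by (intro prod_mono conjI sum_nonneg) auto
    also have "\<dots> = (\<Prod>i\<in>- {i0}. K i) * real J ^ (R - 1)"
      unfolding prod_indexed_growth card_I ..
    finally show ?thesis .
  qed
  \<comment> \<open>A box of sides \<open>J / (m * w i)\<close> lies in the simplex, as each of at most \<open>m\<close> coordinates
    uses up at most \<open>J / m\<close>.\<close>
  define m where "m = real CARD('m)"
  have m: "m > 0" by (simp add: m_def)
  define M where "M i J = (if i \<in> I then nat \<lfloor>real J / (m * w i)\<rfloor> else 0)" for i and J :: nat
  have "\<exists>k>0. \<forall>J::nat. k * ?J i J \<le> (\<Sum>k\<le>M i J. a i k)" for i
  proof (cases "i \<in> I")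
    case True
    have "c i / 2 * (1 / (m * w i)) * real J \<le> (\<Sum>k\<le>M i J. a i k)" for J :: nat
    proof -
      have "real J / (m * w i) \<le> real (M i J) + 1" using True unfolding M_def by simp linarith
      then have "c i / 2 * (real J / (m * w i)) \<le> c i / 2 * (real (M i J) + 1)"
        using c(1)[of i] by (intro mult_left_mono) auto
      also have "\<dots> \<le> (\<Sum>k\<le>M i J. n i k / 2 ^ (d i * k))"
        by (rule discounted_sum_ge[OF d c])
      finally show ?thesis by (simp add: a_I[OF True])
    qed
    moreover have "c i / 2 * (1 / (m * w i)) > 0" using c(1)[of i] m w[of i] by simp
    ultimately show ?thesis using True by auto
  next
    case False
    have "c i \<le> a i 0" using c(2)[of i 0] by (simp add: a_def)
    then show ?thesis using False c(1)[of i] by (auto simp: M_def)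
  qed
  then obtain k where k: "\<And>i. k i > 0" "\<And>i J. k i * ?J i J \<le> (\<Sum>k\<le>M i J. a i k)" by metis
  have g_ge: "(\<Prod>i\<in>- {i0}. k i) * real J ^ (R - 1) \<le> ?g J" for J :: nat
  proof -
    let ?B = "Pi\<^sub>E (- {i0}) (\<lambda>i. {..M i J})"
    have "(\<Prod>i\<in>- {i0}. k i) * real J ^ (R - 1) = (\<Prod>i\<in>- {i0}. k i * ?J i J)"
      unfolding prod_indexed_growth card_I ..
    also have "\<dots> \<le> (\<Prod>i\<in>- {i0}. \<Sum>k\<le>M i J. a i k)"
      using k(2) less_imp_le[OF k(1)] by (intro prod_mono) (auto intro!: mult_nonneg_nonneg)
    also have "\<dots> = (\<Sum>j\<in>?B. \<Prod>i\<in>- {i0}. a i (j i))"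
      by (rule prod_sum_PiE) auto
    also have "\<dots> \<le> ?g J"
    proof (rule sum_mono2)
      show "finite (?S' J)" by (rule finite_weighted_simplex_slice[OF w])
      show "?B \<subseteq> ?S' J"
      proof
        fix j assume j: "j \<in> ?B"
        have "?rest j \<le> (\<Sum>i\<in>- {i0}. real J / m)"
        proof (rule sum_mono)
          fix i assume "i \<in> - {i0}"
          then have "j i \<le> M i J" using j by (auto simp: PiE_iff)
          moreover have "real (M i J) \<le> real J / (m * w i)"
            using m w[of i] by (simp add: M_def)
          ultimately have "real (j i) \<le> real J / (m * w i)" by linarith
          then show "real (j i) * w i \<le> real J / m" using m w[of i] by (simp add: field_simps)
        qed
        also have "\<dots> = real (card (- {i0})) * (real J / m)" by simp
        also have "\<dots> \<le> m * (real J / m)"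
          using m by (intro mult_right_mono) (auto simp: m_def card_mono)
        finally show "j \<in> ?S' J" using j m by (simp add: PiE_iff)
      qed
      show "0 \<le> (\<Prod>i\<in>- {i0}. a i (j i))" for j using a0 by (intro prod_nonneg) auto
    qed
    finally show ?thesis .
  qed
  have "lesssim_on {J::nat. J \<ge> 1} ?f (\<lambda>J. 2 powr (real J * \<rho>) * real J ^ (R - 1))"
    unfolding lesssim_on_def
  proof (intro exI conjI ballI)
    show "C i0 * (\<Prod>i\<in>- {i0}. K i) > 0" using C_pos K(1) by (intro mult_pos_pos prod_pos) auto
    fix J :: nat assume J: "J \<in> {J. J \<ge> 1}"
    have "C i0 * (2 powr (real J * \<rho>) * ?g J) \<le>
        C i0 * (2 powr (real J * \<rho>) * ((\<Prod>i\<in>- {i0}. K i) * real J ^ (R - 1)))"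
      using C_pos[of i0] g_le[of J] J by (intro mult_left_mono) auto
    then show "?f J \<le> C i0 * (\<Prod>i\<in>- {i0}. K i) * (2 powr (real J * \<rho>) * real J ^ (R - 1))"
      using f_le[of J] by (simp only: ac_simps)
  qed
  moreover have "lesssim_on {J::nat. J \<ge> 1} (\<lambda>J. 2 powr (real J * \<rho>) * real J ^ (R - 1)) ?f"
    unfolding lesssim_on_def
  proof (intro exI conjI ballI)
    define e where "e = c i0 / 2 ^ d i0 * (\<Prod>i\<in>- {i0}. k i)"
    have e: "e > 0" unfolding e_def using c(1) k(1) by (intro mult_pos_pos prod_pos) auto
    then show "1 / e > 0" by simp
    fix J :: nat
    have "c i0 / 2 ^ d i0 * (2 powr (real J * \<rho>) * ((\<Prod>i\<in>- {i0}. k i) * real J ^ (R - 1))) \<le>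
        c i0 / 2 ^ d i0 * (2 powr (real J * \<rho>) * ?g J)"
      using c(1)[of i0] g_ge[of J] by (intro mult_left_mono) auto
    then have "e * (2 powr (real J * \<rho>) * real J ^ (R - 1)) \<le> ?f J"
      using f_ge[of J] by (simp only: e_def ac_simps)
    then show "2 powr (real J * \<rho>) * real J ^ (R - 1) \<le> 1 / e * ?f J"
      using e by (simp add: field_simps)
  qed
  ultimately show ?thesis by (simp add: sim_on_def)
qed

section \<open>Dimension asymptotics\<close>

theorem theorem3p3:
  fixes d :: "'m::finite \<Rightarrow> nat"
    and \<Omega> :: "'m \<Rightarrow> point set"
    and s :: "'m \<Rightarrow> real"
    and H :: "'m \<Rightarrow> (point \<Rightarrow> real) set"
    and ip :: "'m \<Rightarrow> (point \<Rightarrow> real) \<Rightarrow> (point \<Rightarrow> real) \<Rightarrow> real"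
    and \<kappa> :: "'m \<Rightarrow> point \<Rightarrow> point \<Rightarrow> real"
    and X :: "'m \<Rightarrow> nat \<Rightarrow> point set"
    and tens :: "('m \<Rightarrow> point \<Rightarrow> real) \<Rightarrow> 'h::{real_inner, complete_space}"
    and w :: "real ^ 'm"
  assumes "\<And>i. d i \<ge> 1"
    and "\<And>i. bounded_lipschitz_domain (d i) (\<Omega> i)"
    and "\<And>i. continuous_on (\<Omega> i \<times> \<Omega> i) (\<lambda>(x, y). \<kappa> i x y)"
    and "\<And>i. positive_definite_kernel (\<Omega> i) (\<kappa> i)"
    and "\<And>i. rkhs (\<Omega> i) (H i) (ip i) (\<kappa> i)"
    and "\<And>i. s i > real (d i) / 2"
    and "\<And>i. coincides_with_sobolev (d i) (\<Omega> i) (s i) (H i) (ip i)"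
    and "\<And>i. data_sites (d i) (\<Omega> i) (X i)"
    and "hilbert_tensor_product H ip tens"
    and "\<And>i. w $ i > 0"
    and "infnorm w = 1"
  defines "\<rho> \<equiv> Max (range (\<lambda>i. real (d i) / w $ i))"
  defines "R \<equiv> card {i. real (d i) / w $ i = \<rho>}"
  shows "sim_on {J::nat. J \<ge> 1}
           (\<lambda>J. real (dim (sparse_tensor_space \<Omega> H ip \<kappa> X tens w J)))
           (\<lambda>J. 2 powr (real J * \<rho>) * real J ^ (R - 1))"
proof -
  have rk: "\<And>i. rkhs (\<Omega> i) (H i) (ip i) (\<kappa> i)" and w: "\<And>i. w $ i > 0" by fact+
  have sites: "finite (X i j)" "X i j \<subseteq> \<Omega> i" "X i j \<subseteq> X i (Suc j)" for i j
    using assms(8)[of i] by (auto simp: data_sites_def)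
  have "\<exists>E. \<forall>j. kernel_basis (\<Omega> i) (H i) (ip i) (\<kappa> i) (X i j) (E j) \<and> E j \<subseteq> E (Suc j)" for i
    using assms(4)[of i] by (intro nested_kernel_bases rk sites)
  then obtain E where E: "\<And>i j. kernel_basis (\<Omega> i) (H i) (ip i) (\<kappa> i) (X i j) (E i j)"
      "\<And>i j. E i j \<subseteq> E i (Suc j)" by metis
  define n where "n i k = real (card (increment (E i) k))" for i k
  have "(\<Sum>k\<le>j. n i k) = real (card (X i j))" for i j
    using sum_card_increment[of "E i" j] E unfolding n_def kernel_basis_def
    by (simp flip: of_nat_sum)
  then have growth: "\<exists>c>0. \<exists>C. \<forall>k. c * 2 ^ (d i * k) \<le> (\<Sum>l\<le>k. n i l) \<and>
      (\<Sum>l\<le>k. n i l) \<le> C * 2 ^ (d i * k)" for i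
    using card_data_sites[OF assms(1,2,8), of i] by simp
  have dim: "real (dim (sparse_tensor_space \<Omega> H ip \<kappa> X tens w J)) =
      (\<Sum>j\<in>{j. (\<Sum>i\<in>UNIV. real (j i) * w $ i) \<le> real J}. \<Prod>i\<in>UNIV. n i (j i))" for J
    unfolding dim_sparse_tensor_space[where \<kappa> = \<kappa> and X = X, OF rk assms(9) E w] n_def by simp
  show ?thesis
    unfolding dim \<rho>_def R_def
    by (rule weighted_simplex_sum_asymptotics[of d "($) w" n, OF assms(1) w _ growth])
       (simp add: n_def)
qed

end
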